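(* Let $d\ge 3$ and $K\ge1$, and let $G$ be a $d$-regular graph of odd diameter $D=2K-1$ that is diameter-maximal. Then $G$ is bipartite, and $G$ consists of two vertex-disjoint Bethe trees of degree $d$ with $K$ levels (together covering all vertices) with an additional $d(d-1)^{K-1}$ edges joining the leaves of one tree to the leaves of the other. The number of vertices of $G$ is exactly $$n=2\left(1+d\sum_{j=0}^{K-2}(d-1)^j\right)=2\left(\frac{d(d-1)^{K-1}-2}{d-2}\right).$$
   Context: Graphs are finite, simple and connected. The algebraic connectivity $AC(G)$ is the second smallest eigenvalue (with multiplicity) of the Laplacian matrix of $G$. A $d$-regular graph $G$ of odd diameter $D=2K-1$ is called diameter-maximal if $AC(G)=d-2\sqrt{d-1}\cos\theta$, where $\theta$ is the smallest positive root of $$\tan(\theta K)=-\frac{\left(2\sqrt{d-1}\cos\theta+d\right)\sin\theta}{\sqrt{d-1}\left(d-2\cos^2\theta\right)+(d-2)\cos\theta}$$ (the right-hand side $d-2\sqrt{d-1}\cos\theta$ is an upper bound for the algebraic connectivity of every $d$-regular graph of diameter $2K-1$). The Bethe tree $T_{K,d}$ of degree $d$ with $K$ levels is the rooted tree whose levels are the vertices at distance $0,1,\dots,K-1$ from the root, in which every non-leaf vertex has degree $d$ and all leaves are at distance $K-1$ from the root (so the root has $d$ children and every other non-leaf vertex has $d-1$ children; for $K=1$ it is a single vertex). *)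

theory Defs
  imports
    Complex_Main
    "HOL-Computational_Algebra.Polynomial"
    "Graph_Theory.Graph_Theory"
    "Jordan_Normal_Form.Char_Poly"
begin

text \<open>
  Finite simple undirected graphs are the symmetric, loop-free digraphs of the locale
  \<^locale>\<open>pair_graph\<close>: an undirected edge is represented by its two arcs \<open>(u, v)\<close> and \<open>(v, u)\<close>.
  Hence the degree of a vertex is its \<^const>\<open>out_degree\<close>.
\<close>

definition regular :: "'a pair_pre_digraph \<Rightarrow> nat \<Rightarrow> bool" where
  "regular G d \<longleftrightarrow> (\<forall>v \<in> pverts G. out_degree G v = d)"

definition bipartite :: "'a pair_pre_digraph \<Rightarrow> bool" where
  "bipartite G \<longleftrightarrow>
     (\<exists>U V. U \<union> V = pverts G \<and> U \<inter> V = {} \<and>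
        (\<forall>(x, y) \<in> parcs G. (x \<in> U \<and> y \<in> V) \<or> (x \<in> V \<and> y \<in> U)))"

text \<open>Both notions below are used for connected graphs only.\<close>

definition gdist :: "'a pair_pre_digraph \<Rightarrow> 'a \<Rightarrow> 'a \<Rightarrow> nat" where
  "gdist G u v = (LEAST n. \<exists>p. pre_digraph.awalk G u p v \<and> length p = n)"

definition gdiam :: "'a pair_pre_digraph \<Rightarrow> nat" where
  "gdiam G = Max {gdist G u v | u v. u \<in> pverts G \<and> v \<in> pverts G}"

definition laplacian_mat :: "'a pair_pre_digraph \<Rightarrow> 'a list \<Rightarrow> real mat" where
  "laplacian_mat G vs = mat (length vs) (length vs)
     (\<lambda>(i, j). if i = j then real (out_degree G (vs ! i))
              else if (vs ! i, vs ! j) \<in> parcs G then - 1 else 0)"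

text \<open>
  The spectrum is the multiset of real roots of the characteristic polynomial; no eigenvalue is
  lost, as the Laplacian is real symmetric. It is independent of the enumeration of the vertices
  (see \<open>laplacian_spectrum_eq\<close> below).
\<close>

definition laplacian_spectrum :: "'a pair_pre_digraph \<Rightarrow> real multiset" where
  "laplacian_spectrum G =
     proots (char_poly (laplacian_mat G (SOME vs. distinct vs \<and> set vs = pverts G)))"

definition algebraic_connectivity :: "'a pair_pre_digraph \<Rightarrow> real" where
  "algebraic_connectivity G = sorted_list_of_multiset (laplacian_spectrum G) ! 1"

text \<open>
  The first two conjuncts say that both sides of the equation are defined; they exclude spurious
  solutions arising from \<open>tan\<close> being \<open>0\<close> at its poles and from division by \<open>0\<close>.
\<close>

definition theta_root :: "nat \<Rightarrow> nat \<Rightarrow> real \<Rightarrow> bool" where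
  "theta_root d K \<theta> \<longleftrightarrow>
     cos (\<theta> * real K) \<noteq> 0 \<and>
     sqrt (real d - 1) * (real d - 2 * (cos \<theta>)\<^sup>2) + (real d - 2) * cos \<theta> \<noteq> 0 \<and>
     tan (\<theta> * real K) =
       - (((2 * sqrt (real d - 1) * cos \<theta> + real d) * sin \<theta>) /
          (sqrt (real d - 1) * (real d - 2 * (cos \<theta>)\<^sup>2) + (real d - 2) * cos \<theta>))"

definition smallest_pos_theta_root :: "nat \<Rightarrow> nat \<Rightarrow> real \<Rightarrow> bool" where
  "smallest_pos_theta_root d K \<theta> \<longleftrightarrow>
     0 < \<theta> \<and> theta_root d K \<theta> \<and> (\<forall>\<phi>. 0 < \<phi> \<and> theta_root d K \<phi> \<longrightarrow> \<theta> \<le> \<phi>)"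

definition diameter_maximal :: "nat \<Rightarrow> nat \<Rightarrow> 'a pair_pre_digraph \<Rightarrow> bool" where
  "diameter_maximal d K G \<longleftrightarrow>
     regular G d \<and> gdiam G = 2 * K - 1 \<and>
     (\<exists>\<theta>. smallest_pos_theta_root d K \<theta> \<and>
        algebraic_connectivity G = real d - 2 * sqrt (real d - 1) * cos \<theta>)"

text \<open>
  The predicate \<^const>\<open>tree\<close> is not applicable here: it forbids directed cycles, and
  each undirected edge gives a directed cycle of length 2.
\<close>

definition undirected_tree :: "'a pair_pre_digraph \<Rightarrow> bool" where
  "undirected_tree T \<longleftrightarrow>
     pair_graph T \<and> connected T \<and> \<not> (\<exists>p. pre_digraph.cycle T p \<and> 3 \<le> length p)"

text \<open>In the tree \<open>T\<close> rooted at \<open>r\<close>, the leaves are the vertices without children.\<close>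

definition children :: "'a pair_pre_digraph \<Rightarrow> 'a \<Rightarrow> 'a \<Rightarrow> 'a set" where
  "children T r v = {w. (v, w) \<in> parcs T \<and> gdist T r w = Suc (gdist T r v)}"

definition leaves :: "'a pair_pre_digraph \<Rightarrow> 'a \<Rightarrow> 'a set" where
  "leaves T r = {v \<in> pverts T. children T r v = {}}"

definition bethe_tree :: "nat \<Rightarrow> nat \<Rightarrow> 'a pair_pre_digraph \<Rightarrow> 'a \<Rightarrow> bool" where
  "bethe_tree d K T r \<longleftrightarrow>
     undirected_tree T \<and> r \<in> pverts T \<and>
     (\<forall>v \<in> pverts T. gdist T r v \<le> K - 1) \<and>
     (\<forall>v \<in> pverts T - leaves T r. out_degree T v = d) \<and>
     (\<forall>v \<in> leaves T r. gdist T r v = K - 1)"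

text \<open>
  The set \<open>X\<close> contains each additional edge once, oriented from the first tree to the second.
\<close>

definition two_bethe_trees :: "nat \<Rightarrow> nat \<Rightarrow> 'a pair_pre_digraph \<Rightarrow> bool" where
  "two_bethe_trees d K G \<longleftrightarrow>
     (\<exists>T\<^sub>1 r\<^sub>1 T\<^sub>2 r\<^sub>2 X.
        bethe_tree d K T\<^sub>1 r\<^sub>1 \<and> bethe_tree d K T\<^sub>2 r\<^sub>2 \<and>
        pverts T\<^sub>1 \<inter> pverts T\<^sub>2 = {} \<and> pverts G = pverts T\<^sub>1 \<union> pverts T\<^sub>2 \<and>
        X \<subseteq> leaves T\<^sub>1 r\<^sub>1 \<times> leaves T\<^sub>2 r\<^sub>2 \<and> card X = d * (d - 1) ^ (K - 1) \<and>
        parcs G = parcs T\<^sub>1 \<union> parcs T\<^sub>2 \<union> X \<union> X\<inverse>)"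

lemma char_poly_laplacian_mat_eq:
  assumes vs: "distinct vs" and ws: "distinct ws" and eq: "set vs = set ws"
  shows "char_poly (laplacian_mat G vs) = char_poly (laplacian_mat G ws)"
proof -
  define n where "n = length vs"
  have lv: "length vs = n" and lw: "length ws = n"
    using vs ws eq distinct_card[of vs] distinct_card[of ws] by (auto simp: n_def)
  have "\<exists>k. k < n \<and> vs ! k = ws ! i" if "i < n" for i
    using that eq lv lw by (metis in_set_conv_nth nth_mem)
  then obtain \<sigma> where \<sigma>: "\<sigma> i < n" "vs ! (\<sigma> i) = ws ! i" if "i < n" for i by metis
  have \<sigma>_inj: "\<sigma> i = \<sigma> j \<longleftrightarrow> i = j" if "i < n" "j < n" for i j
    using \<sigma>[OF that(1)] \<sigma>[OF that(2)] that ws lw by (metis nth_eq_iff_index_eq)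
  define P where "P = mat n n (\<lambda>(i, k). if k = \<sigma> i then 1 else (0 :: real))"
  define Q where "Q = mat n n (\<lambda>(k, i). if k = \<sigma> i then 1 else (0 :: real))"
  let ?A = "laplacian_mat G vs" and ?B = "laplacian_mat G ws"
  have c: "P \<in> carrier_mat n n" "Q \<in> carrier_mat n n" "?A \<in> carrier_mat n n" "?B \<in> carrier_mat n n"
    by (auto simp: P_def Q_def laplacian_mat_def lv lw)
  have PM: "(P * M) $$ (i, j) = M $$ (\<sigma> i, j)"
    if "M \<in> carrier_mat n n" "i < n" "j < n" for M i j
  proof -
    have "(P * M) $$ (i, j) = (\<Sum>k<n. (if k = \<sigma> i then 1 else 0) * M $$ (k, j))"
      using that by (auto simp: P_def scalar_prod_def lessThan_atLeast0 intro!: sum.cong)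
    also have "\<dots> = (\<Sum>k<n. if k = \<sigma> i then M $$ (k, j) else 0)"
      by (intro sum.cong) auto
    also have "\<dots> = M $$ (\<sigma> i, j)" using \<sigma>[OF that(2)] by simp
    finally show ?thesis .
  qed
  have MQ: "(M * Q) $$ (i, j) = M $$ (i, \<sigma> j)"
    if "M \<in> carrier_mat n n" "i < n" "j < n" for M i j
  proof -
    have "(M * Q) $$ (i, j) = (\<Sum>k<n. M $$ (i, k) * (if k = \<sigma> j then 1 else 0))"
      using that by (auto simp: Q_def scalar_prod_def lessThan_atLeast0 intro!: sum.cong)
    also have "\<dots> = (\<Sum>k<n. if k = \<sigma> j then M $$ (i, k) else 0)"
      by (intro sum.cong) auto
    also have "\<dots> = M $$ (i, \<sigma> j)" using \<sigma>[OF that(3)] by simp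
    finally show ?thesis .
  qed
  have PQ: "P * Q = 1\<^sub>m n"
  proof (rule eq_matI)
    fix i j assume "i < dim_row (1\<^sub>m n :: real mat)" "j < dim_col (1\<^sub>m n :: real mat)"
    then have ij: "i < n" "j < n" by auto
    show "(P * Q) $$ (i, j) = 1\<^sub>m n $$ (i, j)"
      using MQ[OF c(1) ij] ij \<sigma>(1) \<sigma>_inj[OF ij] by (auto simp: P_def)
  qed (use c in auto)
  have QP: "Q * P = 1\<^sub>m n"
    using mat_mult_left_right_inverse[OF c(1,2) PQ] .
  have "?B = P * ?A * Q"
  proof (rule eq_matI)
    fix i j assume "i < dim_row (P * ?A * Q)" "j < dim_col (P * ?A * Q)"
    then have ij: "i < n" "j < n" using c by auto
    have "(P * ?A * Q) $$ (i, j) = ?A $$ (\<sigma> i, \<sigma> j)"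
      using MQ[OF mult_carrier_mat[OF c(1,3)] ij] PM[OF c(3) ij(1) \<sigma>(1)[OF ij(2)]] by simp
    also have "\<dots> = ?B $$ (i, j)"
      using ij \<sigma> \<sigma>_inj[OF ij] by (simp add: laplacian_mat_def lv lw)
    finally show "?B $$ (i, j) = (P * ?A * Q) $$ (i, j)" by simp
  qed (use c in auto)
  then have "similar_mat ?B ?A"
    using similar_matI[of ?B ?A P Q n] c PQ QP by blast
  then show ?thesis by (metis char_poly_similar)
qed

lemma laplacian_spectrum_eq:
  assumes "distinct vs" "set vs = pverts G"
  shows "laplacian_spectrum G = proots (char_poly (laplacian_mat G vs))"
proof -
  let ?ws = "SOME vs. distinct vs \<and> set vs = pverts G"
  have "distinct ?ws \<and> set ?ws = pverts G"
    by (rule someI[of "\<lambda>vs. distinct vs \<and> set vs = pverts G" vs]) (use assms in simp)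
  with assms show ?thesis
    unfolding laplacian_spectrum_def by (metis char_poly_laplacian_mat_eq)
qed

end

theory Submission
  imports "HOL-Analysis.Function_Topology" Defs
begin

text \<open>
  Let \<open>x\<close> and \<open>y\<close> be at distance \<open>2 * K - 1\<close>, so that the balls of radius \<open>K - 1\<close> around them are
  disjoint. On the graph that the theorem describes, the Laplacian eigenvalue
  \<open>\<lambda> = d - 2 * sqrt (d - 1) * cos \<theta>\<close> has an eigenfunction that is radial on each tree and
  antisymmetric under exchanging them: its values \<open>a j\<close> at depth \<open>j\<close> satisfy the recurrence of the
  \<open>d\<close>-regular tree and the boundary condition \<open>a K = - a (K - 1)\<close>, and it is this boundary condition
  that the equation for \<open>tan (\<theta> * K)\<close> encodes. For \<open>K \<ge> 2\<close> the smallest root lies below \<open>pi / K\<close>,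
  which makes \<open>a\<close> positive and strictly decreasing up to depth \<open>K - 1\<close>
  (\<open>smallest_theta_root_bounds\<close>, \<open>radial_profile\<close>).

  In an arbitrary \<open>G\<close> the profile is transplanted to the two balls. The test function
  \<open>\<alpha> * f - \<beta> * h\<close>, with \<open>f\<close> and \<open>h\<close> the profile in the distance from \<open>x\<close> and from \<open>y\<close> cut off outside
  the balls, has mean \<open>0\<close> for suitable \<open>\<alpha>, \<beta> > 0\<close>, so its Rayleigh quotient is at least the
  algebraic connectivity (\<open>algebraic_connectivity_rayleigh\<close>). It is also at most \<open>\<lambda>\<close>: each vertex
  of a ball except the centre has at least one neighbour one level lower, and as the profile
  decreases, the neighbour sum is smallest if all other neighbours lie one level higher or, for a
  vertex on the boundary of its ball, on the boundary of the other ball (\<open>tight_sum\<close>).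

  Diameter-maximality says that these two bounds coincide, hence every vertex of the balls is extremal
  (\<open>tight_of_rayleigh\<close>): it has at most one lower neighbour, none on its own level, and from the
  boundary of a ball every remaining arc leads to the boundary of the other ball. So the two balls are
  Bethe trees, no arc leaves their union, and by connectedness they cover \<open>G\<close>. The rest is counting,
  and colouring by the parity of the depth, with opposite conventions in the two trees.

  For \<open>K = 1\<close> the hypotheses are contradictory: the smallest root is \<open>pi\<close>, which would give algebraic
  connectivity \<open>d + 2 * sqrt (d - 1)\<close>, while the difference of the indicators of two adjacent
  vertices shows that it is at most \<open>d + 1\<close>.
\<close>

section \<open>Distances, levels and neighbourhoods\<close>

lemma (in pair_graph) connected_awalk:
  assumes "connected G" "u \<in> pverts G" "v \<in> pverts G"
  shows "\<exists>p. awalk u p v"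
proof -
  have "u \<rightarrow>\<^sup>*\<^bsub>mk_symmetric G\<^esub> v"
    using assms unfolding connected_def strongly_connected_def by simp
  then have "u \<rightarrow>\<^sup>*\<^bsub>G\<^esub> v"
    using reachable_mk_symmetric_eq[OF pair_sym_arcs] by simp
  then show ?thesis using reachable_awalk by blast
qed

lemma (in pair_wf_digraph) awalk_snoc:
  assumes "awalk u p v" "(v, w) \<in> parcs G"
  shows "awalk u (p @ [(v, w)]) w"
  using assms by (simp add: awalk_simps in_arcsD2)

lemma (in pair_graph) connectedI:
  assumes "r \<in> pverts G" "\<And>v. v \<in> pverts G \<Longrightarrow> \<exists>p. awalk r p v"
  shows "connected G"
proof -
  have "r \<rightarrow>\<^sup>*\<^bsub>G\<^esub> v" if "v \<in> pverts G" for v using assms(2)[OF that] reachable_awalk by blast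
  then have "u \<rightarrow>\<^sup>*\<^bsub>G\<^esub> v" if "u \<in> pverts G" "v \<in> pverts G" for u v
    using that symmetric_reachable'[of r u] reachable_trans by blast
  then show ?thesis using assms(1) reachable_mk_symmetric_eq[OF pair_sym_arcs]
    unfolding connected_def strongly_connected_def by auto
qed

text \<open>
  The properties that characterise the distance from \<open>r\<close>. They pass from a graph to the subgraph
  induced on a ball around \<open>r\<close>, so distances in such a ball need no analysis of walks.
\<close>
locale level_function = pair_graph +
  fixes r :: 'a and lev :: "'a \<Rightarrow> nat"
  assumes root: "r \<in> pverts G"
    and lev_root: "lev r = 0"
    and lev_step: "(v, w) \<in> parcs G \<Longrightarrow> lev w \<le> Suc (lev v)"
    and lev_pred: "v \<in> pverts G \<Longrightarrow> v \<noteq> r \<Longrightarrow> \<exists>w. (w, v) \<in> parcs G \<and> lev v = Suc (lev w)"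
begin

lemma lev_le_length: "awalk u p v \<Longrightarrow> lev v \<le> lev u + length p"
proof (induction p arbitrary: u)
  case (Cons e p)
  then have "lev v \<le> lev (snd e) + length p" "e \<in> parcs G" "u = fst e"
    by (auto simp: awalk_Cons_iff)
  with lev_step[of u "snd e"] show ?case by simp
qed (simp add: awalk_Nil_iff)

lemma walk_of_length_lev: "v \<in> pverts G \<Longrightarrow> \<exists>p. awalk r p v \<and> length p = lev v"
proof (induction "lev v" arbitrary: v rule: less_induct)
  case less
  show ?case
  proof (cases "v = r")
    case True
    then show ?thesis using root lev_root by (intro exI[of _ "[]"]) (simp add: awalk_Nil_iff)
  next
    case False
    then obtain w where w: "(w, v) \<in> parcs G" "lev v = Suc (lev w)"
      using lev_pred less.prems by blast
    then obtain p where "awalk r p w" "length p = lev w"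
      using less.hyps[of w] by (auto dest: in_arcsD1)
    then show ?thesis using w awalk_snoc[of r p w v] by (intro exI[of _ "p @ [(w, v)]"]) auto
  qed
qed

lemma connected_of_levels: "connected G"
  using connectedI root walk_of_length_lev by blast

lemma gdist_eq_lev:
  assumes "v \<in> pverts G"
  shows "gdist G r v = lev v"
  unfolding gdist_def
proof (rule Least_equality)
  show "\<exists>p. awalk r p v \<and> length p = lev v" using walk_of_length_lev[OF assms] .
  show "lev v \<le> n" if "\<exists>p. awalk r p v \<and> length p = n" for n
    using that lev_le_length[of r _ v] lev_root by auto
qed

end

lemma (in pair_graph) gdist_level_function:
  assumes "connected G" "r \<in> pverts G"
  shows "level_function G r (gdist G r)"
proof unfold_locales
  have walk: "\<exists>p. awalk r p v \<and> length p = gdist G r v" if "v \<in> pverts G" for v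
    using connected_awalk[OF assms that] unfolding gdist_def by (rule_tac LeastI_ex) auto
  have least: "gdist G r v \<le> length p" if "awalk r p v" for p v
    using that unfolding gdist_def by (intro Least_le) auto
  show "r \<in> pverts G" by fact
  show "gdist G r r = 0" using least[of "[]" r] assms by (simp add: awalk_Nil_iff)
  show step: "gdist G r w \<le> Suc (gdist G r v)" if vw: "(v, w) \<in> parcs G" for v w
  proof -
    obtain p where "awalk r p v" "length p = gdist G r v" using walk vw in_arcsD1 by blast
    then show ?thesis using least[OF awalk_snoc[OF _ vw], of p] by simp
  qed
  show "\<exists>w. (w, v) \<in> parcs G \<and> gdist G r v = Suc (gdist G r w)" if v: "v \<in> pverts G" "v \<noteq> r" for v
  proof -
    obtain p where p: "awalk r p v" "length p = gdist G r v" using walk v by blast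
    then have "p \<noteq> []" using v by (auto simp: awalk_Nil_iff)
    then obtain q e where q: "p = q @ [e]" by (metis rev_exhaust)
    then have "awalk r q (fst e)" "e \<in> parcs G" "snd e = v"
      using p(1) by (auto simp: awalk_simps)
    then have "(fst e, v) \<in> parcs G" "gdist G r (fst e) \<le> length q" using least by auto
    then show ?thesis using step p q by (intro exI[of _ "fst e"]) (auto intro: le_antisym)
  qed
qed

lemma (in level_function) lev_eq_0_iff: "v \<in> pverts G \<Longrightarrow> lev v = 0 \<longleftrightarrow> v = r"
  using lev_pred lev_root by fastforce

text \<open>Induction along a shortest walk from \<open>y\<close> to \<open>w\<close>, one predecessor at a time.\<close>
lemma (in pair_graph) gdist_triangle:
  assumes "connected G" "x \<in> pverts G" "y \<in> pverts G" "w \<in> pverts G"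
  shows "gdist G x y \<le> gdist G x w + gdist G y w"
proof -
  interpret X: level_function G x "gdist G x" using gdist_level_function assms by blast
  interpret Y: level_function G y "gdist G y" using gdist_level_function assms by blast
  show ?thesis using assms(4)
  proof (induction "gdist G y w" arbitrary: w)
    case 0
    then show ?case using Y.lev_eq_0_iff by simp
  next
    case (Suc n)
    then have "w \<noteq> y" using Y.lev_root by auto
    then obtain w' where w': "(w', w) \<in> parcs G" "gdist G y w = Suc (gdist G y w')"
      using Y.lev_pred Suc.prems by blast
    then show ?case using Suc.hyps(1)[of w'] Suc.hyps(2) X.lev_step[of w w'] arcs_symmetric in_arcsD1[of w' w]
      by fastforce
  qed
qed

text \<open>
  Both neighbours on a cycle of a vertex of maximal level have a lower level, so they coincide, and
  the cycle has length at most 2.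
\<close>
lemma no_long_cycle:
  assumes wf: "pair_wf_digraph T"
    and ne: "\<And>v w. (v, w) \<in> parcs T \<Longrightarrow> lev v \<noteq> (lev w :: nat)"
    and uniq: "\<And>u v w. (u, v) \<in> parcs T \<Longrightarrow> (v, w) \<in> parcs T \<Longrightarrow> lev u < lev v \<Longrightarrow> lev w < lev v \<Longrightarrow> u = w"
    and cyc: "pre_digraph.cycle T p"
  shows "length p < 3"
proof (rule ccontr)
  assume len: "\<not> length p < 3"
  interpret pair_wf_digraph T by fact
  define n where "n = length p"
  have n: "n \<ge> 3" using len by (simp add: n_def)
  obtain u where u: "awalk u p u" "distinct (tl (awalk_verts u p))" "p \<noteq> []"
    using cyc unfolding cycle_def by blast
  \<comment> \<open>The vertices of the cycle, in cyclic order.\<close>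
  define c where "c i = snd (p ! i)" for i
  have "tl (awalk_verts u p) = map snd p"
    using u(1,3) awalk_verts_conv'[of u p u] by (auto simp: awalk_def)
  then have "distinct (map snd p)" using u(2) by simp
  then have inj: "c i = c j \<longleftrightarrow> i = j" if "i < n" "j < n" for i j
    using nth_eq_iff_index_eq[of "map snd p" i j] that by (simp add: c_def n_def)
  have arc: "(c i, c (Suc i mod n)) \<in> parcs T" if "i < n" for i
  proof -
    have "awalk u (take i p @ p ! i # drop (Suc i) p) u"
      using u(1) that by (simp add: id_take_nth_drop[symmetric] n_def)
    then have "awalk (c i) (drop (Suc i) p) u"
      unfolding awalk_append_iff by (simp add: awalk_Cons_iff c_def)
    show ?thesis
    proof (cases "Suc i < n")
      case True
      then have "drop (Suc i) p = p ! Suc i # drop (Suc (Suc i)) p"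
        by (simp add: Cons_nth_drop_Suc n_def)
      with \<open>awalk (c i) (drop (Suc i) p) u\<close> have "p ! Suc i \<in> parcs T" "fst (p ! Suc i) = c i"
        by (auto simp: awalk_Cons_iff)
      then show ?thesis using True by (metis c_def mod_less prod.collapse)
    next
      case False
      then have i: "Suc i = n" using that by simp
      then have "c i = u" using \<open>awalk (c i) (drop (Suc i) p) u\<close> by (simp add: n_def awalk_Nil_iff)
      moreover have "p = p ! 0 # drop 1 p" using u(3) by (cases p) auto
      then have "p ! 0 \<in> parcs T" "fst (p ! 0) = u" using u(1) by (metis awalk_Cons_iff)+
      ultimately show ?thesis using i by (metis c_def mod_self prod.collapse)
    qed
  qed
  define M where "M = Max ((\<lambda>i. lev (c i)) ` {..<n})"
  have "finite ((\<lambda>i. lev (c i)) ` {..<n})" "(\<lambda>i. lev (c i)) ` {..<n} \<noteq> {}"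
    using n by (auto simp: lessThan_empty_iff)
  then have "M \<in> (\<lambda>i. lev (c i)) ` {..<n}" and "\<And>j. j < n \<Longrightarrow> lev (c j) \<le> M"
    unfolding M_def by (auto intro: Max_in Max_ge)
  then obtain i where i: "i < n" "\<And>j. j < n \<Longrightarrow> lev (c j) \<le> lev (c i)"
    by auto
  define k where "k = (if i = 0 then n - 1 else i - 1)"
  define l where "l = (if Suc i = n then 0 else Suc i)"
  have k: "k < n" "Suc k mod n = i" using i n by (auto simp: k_def)
  have l: "l < n" "Suc i mod n = l" using i n by (auto simp: l_def)
  have a: "(c k, c i) \<in> parcs T" "(c i, c l) \<in> parcs T"
    using arc[OF k(1)] arc[OF i(1)] k l by auto
  have "lev (c k) < lev (c i)" "lev (c l) < lev (c i)"
    using ne[OF a(1)] ne[OF a(2)] i(2)[OF k(1)] i(2)[OF l(1)] by auto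
  then have "k = l" using uniq[OF a] inj k l by blast
  then show False using n i by (auto simp: k_def l_def split: if_splits)
qed

definition nbrs :: "'a pair_pre_digraph \<Rightarrow> 'a \<Rightarrow> 'a set" where
  "nbrs G v = {w. (v, w) \<in> parcs G}"

context pair_graph begin

lemma finite_nbrs [simp]: "finite (nbrs G v)"
  by (rule finite_subset[OF _ pair_finite_verts]) (auto simp: nbrs_def dest: in_arcsD2)

lemma nbrs_sym: "w \<in> nbrs G v \<longleftrightarrow> v \<in> nbrs G w"
  by (auto simp: nbrs_def intro: arcs_symmetric)

lemma nbrs_irrefl: "v \<notin> nbrs G v"
  by (auto simp: nbrs_def dest: no_loops')

lemma nbrs_in_verts: "w \<in> nbrs G v \<Longrightarrow> w \<in> pverts G" "w \<in> nbrs G v \<Longrightarrow> v \<in> pverts G"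
  by (auto simp: nbrs_def dest: in_arcsD1 in_arcsD2)

lemma out_degree_nbrs: "out_degree G v = card (nbrs G v)"
proof -
  have "out_arcs G v = (\<lambda>w. (v, w)) ` nbrs G v"
    by (auto simp: out_arcs_def nbrs_def)
  then show ?thesis by (simp add: out_degree_def card_image inj_on_def)
qed

end

section \<open>The Rayleigh bound for the algebraic connectivity\<close>

lemma second_smallest_le:
  fixes M :: "'a::linorder multiset"
  assumes "x \<in># M" "y \<in># M" "x < y"
  shows "sorted_list_of_multiset M ! 1 \<le> y"
proof -
  let ?xs = "sorted_list_of_multiset M"
  have s: "sorted ?xs" by simp
  obtain i where i: "i < length ?xs" "?xs ! i = x"
    using assms(1) by (metis in_set_conv_nth set_sorted_list_of_multiset)
  obtain j where j: "j < length ?xs" "?xs ! j = y"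
    using assms(2) by (metis in_set_conv_nth set_sorted_list_of_multiset)
  have "i < j"
    using assms(3) i j sorted_nth_mono[OF s, of j i] by (meson leD leI)
  then show ?thesis
    using sorted_nth_mono[OF s, of 1 j] j by simp
qed

definition bilin_form :: "'a set \<Rightarrow> ('a \<Rightarrow> 'a \<Rightarrow> real) \<Rightarrow> ('a \<Rightarrow> real) \<Rightarrow> ('a \<Rightarrow> real) \<Rightarrow> real" where
  "bilin_form V A f h = (\<Sum>v\<in>V. f v * (\<Sum>w\<in>V. A v w * h w))"

lemma bilin_form_commute:
  assumes "\<And>v w. A v w = A w v"
  shows "bilin_form V A f h = bilin_form V A h f"
  unfolding bilin_form_def sum_distrib_left
  by (subst sum.swap) (intro sum.cong refl, subst assms, simp add: mult_ac)

text \<open>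
  The functions on \<open>V\<close> of mean \<open>0\<close> and norm \<open>1\<close>, extended by \<open>0\<close>, form a compact set in the product
  topology, so the quadratic form attains its minimum there; homogeneity extends the bound to all
  functions of mean \<open>0\<close>.
\<close>
lemma minimize_quad_form:
  fixes A :: "'a \<Rightarrow> 'a \<Rightarrow> real"
  assumes fin: "finite V" and xy: "x \<in> V" "y \<in> V" "x \<noteq> y"
  obtains g where "(\<Sum>v\<in>V. g v) = 0" "(\<Sum>v\<in>V. (g v)\<^sup>2) = 1"
    "\<And>f. (\<Sum>v\<in>V. f v) = 0 \<Longrightarrow> bilin_form V A g g * (\<Sum>v\<in>V. (f v)\<^sup>2) \<le> bilin_form V A f f"
proof -
  define B where "B = PiE UNIV (\<lambda>v. if v \<in> V then {-1..1::real} else {0})"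
  define S where "S = B \<inter> {f. (\<Sum>v\<in>V. f v) = 0} \<inter> {f. (\<Sum>v\<in>V. (f v)\<^sup>2) = 1}"
  have "compactin (product_topology (\<lambda>i. euclidean) UNIV) B"
    unfolding B_def compactin_PiE by auto
  then have "compact B"
    by (simp add: euclidean_product_topology)
  moreover have "closed {f. (\<Sum>v\<in>V. f v) = (0::real)}"
    by (intro closed_Collect_eq continuous_intros continuous_on_product_coordinates)
  moreover have "closed {f. (\<Sum>v\<in>V. (f v)\<^sup>2) = (1::real)}"
    by (intro closed_Collect_eq continuous_intros continuous_on_product_coordinates)
  ultimately have "compact S"
    unfolding S_def by (intro compact_Int_closed)
  have normalise: "\<exists>g\<in>S. \<forall>v\<in>V. g v = f v / sqrt (\<Sum>v\<in>V. (f v)\<^sup>2)"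
    if f: "(\<Sum>v\<in>V. f v) = 0" "(\<Sum>v\<in>V. (f v)\<^sup>2) > 0" for f
  proof -
    define r where "r = sqrt (\<Sum>v\<in>V. (f v)\<^sup>2)"
    have r: "r > 0" "r\<^sup>2 = (\<Sum>v\<in>V. (f v)\<^sup>2)" using f by (auto simp: r_def)
    define g where "g = (\<lambda>v. if v \<in> V then f v / r else 0)"
    have g_out: "g v = 0" if "v \<notin> V" for v using that by (simp add: g_def)
    have "(\<Sum>v\<in>V. g v) = (\<Sum>v\<in>V. f v) / r"
      unfolding sum_divide_distrib by (intro sum.cong) (auto simp: g_def)
    then have g0: "(\<Sum>v\<in>V. g v) = 0" using f by simp
    have "(\<Sum>v\<in>V. (g v)\<^sup>2) = (\<Sum>v\<in>V. (f v)\<^sup>2) / r\<^sup>2"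
      unfolding sum_divide_distrib by (intro sum.cong) (auto simp: g_def power_divide)
    then have g1: "(\<Sum>v\<in>V. (g v)\<^sup>2) = 1" using r f by simp
    have "\<bar>g v\<bar> \<le> 1" if "v \<in> V" for v
      using member_le_sum[of v V "\<lambda>v. (g v)\<^sup>2"] that fin g1
      by (simp add: abs_square_le_1)
    then have "g \<in> B"
      unfolding B_def using g_out by (intro PiE_I) (auto simp: abs_le_iff minus_le_iff)
    with g0 g1 show ?thesis unfolding S_def by (intro bexI[of _ g]) (auto simp: g_def r_def)
  qed
  have "S \<noteq> {}"
  proof -
    define f where "f v = (if v = x then 1 else if v = y then -1 else 0 :: real)" for v
    have "sum h V = sum h {x, y}" if "\<And>v. v \<noteq> x \<Longrightarrow> v \<noteq> y \<Longrightarrow> h v = 0" for h :: "'a \<Rightarrow> real"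
      using xy fin that by (intro sum.mono_neutral_right) auto
    from this[of f] this[of "\<lambda>v. (f v)\<^sup>2"]
    have "(\<Sum>v\<in>V. f v) = (\<Sum>v\<in>{x,y}. f v)" "(\<Sum>v\<in>V. (f v)\<^sup>2) = (\<Sum>v\<in>{x,y}. (f v)\<^sup>2)"
      by (simp_all add: f_def del: sum.insert)
    moreover have "(\<Sum>v\<in>{x,y}. f v) = 0" "(\<Sum>v\<in>{x,y}. (f v)\<^sup>2) = 2"
      using xy by (auto simp: f_def)
    ultimately show ?thesis using normalise[of f] by auto
  qed
  moreover have "continuous_on S (\<lambda>f. bilin_form V A f f)"
    unfolding bilin_form_def
    by (intro continuous_intros continuous_on_subset[OF continuous_on_product_coordinates] subset_UNIV)
  ultimately obtain g where g: "g \<in> S" and min: "\<And>h. h \<in> S \<Longrightarrow> bilin_form V A g g \<le> bilin_form V A h h"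
    using continuous_attains_inf[OF \<open>compact S\<close>] by blast
  show thesis
  proof (rule that)
    show "(\<Sum>v\<in>V. g v) = 0" "(\<Sum>v\<in>V. (g v)\<^sup>2) = 1" using g by (auto simp: S_def)
    fix f :: "'a \<Rightarrow> real" assume f0: "(\<Sum>v\<in>V. f v) = 0"
    let ?n = "\<Sum>v\<in>V. (f v)\<^sup>2"
    show "bilin_form V A g g * ?n \<le> bilin_form V A f f"
    proof (cases "?n > 0")
      case True
      then obtain h where h: "h \<in> S" "\<And>v. v \<in> V \<Longrightarrow> h v = f v / sqrt ?n"
        using normalise[OF f0] by blast
      have "bilin_form V A h h = bilin_form V A f f / (sqrt ?n * sqrt ?n)"
        unfolding bilin_form_def sum_divide_distrib sum_distrib_left
        by (intro sum.cong refl) (simp add: h)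
      then have "bilin_form V A h h = bilin_form V A f f / ?n" using True by simp
      with min[OF h(1)] True show ?thesis by (simp add: pos_le_divide_eq)
    next
      case False
      then have "?n = 0" by (meson sum_nonneg zero_le_power2 not_le order_antisym)
      then have "f v = 0" if "v \<in> V" for v using fin that by (simp add: sum_nonneg_eq_0_iff)
      then show ?thesis by (simp add: bilin_form_def)
    qed
  qed
qed

text \<open>
  The first variation. As the row sums vanish, the residual \<open>h = A g - m g\<close> again has mean \<open>0\<close>, so
  \<open>g + t h\<close> is an admissible competitor for every \<open>t\<close>; its excess energy is
  \<open>2 t n + O(t\<^sup>2)\<close> with \<open>n\<close> the squared norm of \<open>h\<close>, which is nonnegative for all \<open>t\<close> only if \<open>n = 0\<close>.
\<close>
lemma minimizer_eigenvector:
  fixes A :: "'a \<Rightarrow> 'a \<Rightarrow> real"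
  assumes fin: "finite V" and sym: "\<And>v w. A v w = A w v"
    and row: "\<And>v. v \<in> V \<Longrightarrow> (\<Sum>w\<in>V. A v w) = 0"
    and g0: "(\<Sum>v\<in>V. g v) = 0" and g1: "bilin_form V A g g = m * (\<Sum>v\<in>V. (g v)\<^sup>2)"
    and min: "\<And>f. (\<Sum>v\<in>V. f v) = 0 \<Longrightarrow> m * (\<Sum>v\<in>V. (f v)\<^sup>2) \<le> bilin_form V A f f"
    and v: "v \<in> V"
  shows "(\<Sum>w\<in>V. A v w * g w) = m * g v"
proof -
  define h where "h u = (\<Sum>w\<in>V. A u w * g w) - m * g u" for u
  define n where "n = (\<Sum>u\<in>V. (h u)\<^sup>2)"
  define c where "c = bilin_form V A h h - m * n"
  have "(\<Sum>u\<in>V. \<Sum>w\<in>V. A u w * g w) = (\<Sum>w\<in>V. (\<Sum>u\<in>V. A w u) * g w)"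
    by (subst sum.swap) (simp add: sum_distrib_right sym)
  also have "\<dots> = 0" by (simp add: row)
  finally have h0: "(\<Sum>u\<in>V. h u) = 0"
    using g0 by (simp add: h_def sum_subtractf flip: sum_distrib_left)
  have n: "bilin_form V A h g - m * (\<Sum>u\<in>V. h u * g u) = n"
    unfolding n_def bilin_form_def sum_distrib_left[of m]
      sum_subtractf[symmetric]
    by (intro sum.cong refl) (simp add: h_def power2_eq_square algebra_simps)
  have le: "0 \<le> 2 * t * n + t\<^sup>2 * c" for t
  proof -
    let ?f = "\<lambda>u. g u + t * h u"
    have f0: "(\<Sum>u\<in>V. ?f u) = 0" using g0 h0 by (simp add: sum.distrib flip: sum_distrib_left)
    have "bilin_form V A ?f ?f = bilin_form V A g g + t * bilin_form V A g h + t * bilin_form V A h g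
       + t\<^sup>2 * bilin_form V A h h"
      unfolding bilin_form_def sum_distrib_left sum.distrib[symmetric]
      by (intro sum.cong refl) (simp add: power2_eq_square algebra_simps)
    moreover have "(\<Sum>u\<in>V. (?f u)\<^sup>2) = (\<Sum>u\<in>V. (g u)\<^sup>2) + 2 * t * (\<Sum>u\<in>V. h u * g u) + t\<^sup>2 * n"
      unfolding n_def sum_distrib_left sum.distrib[symmetric]
      by (intro sum.cong refl) (simp add: power2_eq_square algebra_simps)
    ultimately show ?thesis
      using min[OF f0] g1 n bilin_form_commute[of A V g h, OF sym]
      unfolding c_def by (simp add: algebra_simps)
  qed
  have "n \<ge> 0" by (simp add: n_def sum_nonneg)
  have "n = 0"
  proof (rule ccontr)
    assume "n \<noteq> 0"
    then have "n > 0" using \<open>n \<ge> 0\<close> by simp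
    \<comment> \<open>Small and negative enough for the linear term to outweigh the quadratic one.\<close>
    define t where "t = - n / (\<bar>c\<bar> + 1)"
    have t: "t < 0" "(\<bar>c\<bar> + 1) * t = - n" using \<open>n > 0\<close> by (auto simp: t_def divide_simps)
    have "t\<^sup>2 * c \<le> t * (t * (\<bar>c\<bar> + 1))"
      unfolding power2_eq_square mult.assoc[symmetric]
      by (intro mult_left_mono) (auto simp: mult_nonpos_nonpos)
    also have "\<dots> = - t * n" using t(2) by (simp add: mult.commute[of t])
    finally have "2 * t * n + t\<^sup>2 * c \<le> t * n" by (simp add: algebra_simps)
    also have "\<dots> < 0" using t \<open>n > 0\<close> by (simp add: mult_neg_pos)
    finally show False using le[of t] by simp
  qed
  then have "h v = 0" using fin v by (simp add: n_def sum_nonneg_eq_0_iff)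
  then show ?thesis by (simp add: h_def)
qed

definition laplacian_kernel :: "'a pair_pre_digraph \<Rightarrow> 'a \<Rightarrow> 'a \<Rightarrow> real" where
  "laplacian_kernel G v w =
     (if v = w then real (out_degree G v) else if (v, w) \<in> parcs G then - 1 else 0)"

lemma (in pair_graph) laplacian_kernel_sum:
  assumes "v \<in> pverts G"
  shows "(\<Sum>w\<in>pverts G. laplacian_kernel G v w * h w) = (\<Sum>w\<in>nbrs G v. h v - h w)"
proof -
  have "laplacian_kernel G v w * h w
      = (if w = v then real (card (nbrs G v)) * h v else 0) - (if w \<in> nbrs G v then h w else 0)" for w
    using nbrs_irrefl[of v] by (auto simp: laplacian_kernel_def out_degree_nbrs nbrs_def)
  then have "(\<Sum>w\<in>pverts G. laplacian_kernel G v w * h w)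
      = real (card (nbrs G v)) * h v - (\<Sum>w\<in>pverts G \<inter> nbrs G v. h w)"
    using assms pair_finite_verts by (simp add: sum_subtractf sum.inter_restrict)
  also have "pverts G \<inter> nbrs G v = nbrs G v" using nbrs_in_verts by auto
  finally show ?thesis by (simp add: sum_subtractf)
qed

lemma eigenvalue_in_laplacian_spectrum:
  assumes vs: "distinct vs" "set vs = pverts G"
    and ev: "\<And>v. v \<in> pverts G \<Longrightarrow> (\<Sum>w\<in>pverts G. laplacian_kernel G v w * g w) = m * g v"
    and nz: "u \<in> pverts G" "g u \<noteq> 0"
  shows "m \<in># laplacian_spectrum G"
proof -
  let ?L = "laplacian_mat G vs" and ?n = "length vs"
  let ?g = "vec ?n (\<lambda>i. g (vs ! i))"
  have L: "?L \<in> carrier_mat ?n ?n" by (simp add: laplacian_mat_def)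
  have "eigenvector ?L ?g m"
    unfolding eigenvector_def
  proof (intro conjI)
    show "?g \<in> carrier_vec (dim_row ?L)" by (simp add: laplacian_mat_def)
    obtain i where i: "i < ?n" "vs ! i = u" using nz vs by (metis in_set_conv_nth)
    then have "?g $ i \<noteq> 0\<^sub>v (dim_row ?L) $ i" using nz by (simp add: laplacian_mat_def)
    then show "?g \<noteq> 0\<^sub>v (dim_row ?L)" by auto
    show "?L *\<^sub>v ?g = m \<cdot>\<^sub>v ?g"
    proof (rule eq_vecI)
      fix i assume "i < dim_vec (m \<cdot>\<^sub>v ?g)"
      then have i: "i < ?n" by simp
      have "(?L *\<^sub>v ?g) $ i = (\<Sum>j<?n. laplacian_kernel G (vs ! i) (vs ! j) * g (vs ! j))"
        using i vs(1) by (auto simp: laplacian_mat_def laplacian_kernel_def scalar_prod_def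
            lessThan_atLeast0 nth_eq_iff_index_eq intro!: sum.cong)
      also have "\<dots> = (\<Sum>w\<in>pverts G. laplacian_kernel G (vs ! i) w * g w)"
        by (rule sum.reindex_bij_betw[OF bij_betw_nth]) (use vs in auto)
      also have "\<dots> = m * g (vs ! i)" using ev i vs by (metis nth_mem)
      finally show "(?L *\<^sub>v ?g) $ i = (m \<cdot>\<^sub>v ?g) $ i" using i by simp
    qed (simp add: laplacian_mat_def)
  qed
  then have "poly (char_poly ?L) m = 0"
    using eigenvalue_root_char_poly[OF L] by (auto simp: eigenvalue_def)
  moreover have "char_poly ?L \<noteq> 0"
    using degree_monic_char_poly[OF L] by (metis coeff_0 zero_neq_one)
  ultimately show ?thesis
    unfolding laplacian_spectrum_eq[OF vs] by simp
qed

text \<open>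
  The half of the Courant-Fischer principle that the theorem needs, without diagonalising the
  Laplacian: the minimum \<open>m\<close> of the quadratic form on functions of mean \<open>0\<close> is an eigenvalue, and it is
  positive because \<open>G\<close> is connected. So \<open>0\<close> and \<open>m\<close> are distinct members of the spectrum, whence its
  second smallest member is at most \<open>m\<close>.
\<close>
lemma (in pair_graph) algebraic_connectivity_rayleigh:
  fixes f :: "'a \<Rightarrow> real"
  assumes con: "connected G" and xy: "x \<in> pverts G" "y \<in> pverts G" "x \<noteq> y"
    and f0: "(\<Sum>v\<in>pverts G. f v) = 0"
  shows "algebraic_connectivity G * (\<Sum>v\<in>pverts G. (f v)\<^sup>2)
    \<le> (\<Sum>v\<in>pverts G. f v * (\<Sum>w\<in>nbrs G v. f v - f w))"
proof -
  let ?V = "pverts G" and ?A = "laplacian_kernel G"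
  have sym: "?A v w = ?A w v" for v w
    using arcs_symmetric by (auto simp: laplacian_kernel_def)
  have row: "(\<Sum>w\<in>?V. ?A v w) = 0" if "v \<in> ?V" for v
    using laplacian_kernel_sum[OF that, of "\<lambda>_. 1"] by simp
  obtain g where g: "(\<Sum>v\<in>?V. g v) = 0" "(\<Sum>v\<in>?V. (g v)\<^sup>2) = 1"
    and min: "\<And>f. (\<Sum>v\<in>?V. f v) = 0 \<Longrightarrow>
        bilin_form ?V ?A g g * (\<Sum>v\<in>?V. (f v)\<^sup>2) \<le> bilin_form ?V ?A f f"
    using minimize_quad_form[OF pair_finite_verts xy] by metis
  define m where "m = bilin_form ?V ?A g g"
  have ev: "(\<Sum>w\<in>?V. ?A v w * g w) = m * g v" if "v \<in> ?V" for v
    using minimizer_eigenvector[OF pair_finite_verts sym row g(1) _ min that] g(2)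
    by (simp add: m_def)
  obtain u where u: "u \<in> ?V" "\<And>v. v \<in> ?V \<Longrightarrow> g v \<le> g u"
  proof -
    have "finite (g ` ?V)" "g ` ?V \<noteq> {}" using pair_finite_verts xy by auto
    from Max_in[OF this] Max_ge[OF this(1)] that show thesis by (metis imageE imageI)
  qed
  have u_pos: "g u > 0"
  proof (rule ccontr)
    assume "\<not> g u > 0"
    then have "g v \<le> 0" if "v \<in> ?V" for v using u(2)[OF that] by simp
    then have "\<forall>v\<in>?V. g v = 0"
      using g(1) sum_nonneg_eq_0_iff[OF pair_finite_verts, of "\<lambda>v. - g v"] by (simp add: sum_negf)
    then show False using g(2) by simp
  qed
  have m_pos: "m > 0"
  proof (rule ccontr)
    assume m: "\<not> m > 0"
    \<comment> \<open>Maximum principle: for \<open>m \<le> 0\<close> the set where \<open>g\<close> is maximal is closed under taking neighbours.\<close>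
    have step: "g w = g u" if v: "v \<in> ?V" "g v = g u" and w: "w \<in> nbrs G v" for v w
    proof -
      have nn: "0 \<le> g v - g w" if "w \<in> nbrs G v" for w
        using u(2) v(2) nbrs_in_verts that by simp
      have "(\<Sum>w\<in>nbrs G v. g v - g w) = m * g u"
        using ev[OF v(1)] laplacian_kernel_sum[OF v(1)] v(2) by simp
      also have "\<dots> \<le> 0" using m u_pos by (simp add: mult_nonpos_nonneg)
      finally have "(\<Sum>w\<in>nbrs G v. g v - g w) = 0" using nn by (meson order_antisym sum_nonneg)
      then show ?thesis using sum_nonneg_eq_0_iff[OF finite_nbrs nn] w v(2) by auto
    qed
    interpret level_function G u "gdist G u" using gdist_level_function con u(1) .
    have "g v = g u" if "v \<in> ?V" for v using that
    proof (induction "gdist G u v" arbitrary: v rule: less_induct)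
      case less
      show ?case
      proof (cases "v = u")
        case False
        then obtain w where w: "(w, v) \<in> parcs G" "gdist G u v = Suc (gdist G u w)"
          using lev_pred less.prems by blast
        then show ?thesis using less.hyps[of w] step[of w v] in_arcsD1 by (auto simp: nbrs_def)
      qed simp
    qed
    then have "(\<Sum>v\<in>?V. g v) = card ?V * g u" by simp
    then show False using g(1) u_pos u(1) pair_finite_verts by auto
  qed
  obtain vs where vs: "distinct vs" "set vs = ?V"
    using finite_distinct_list[OF pair_finite_verts] by blast
  have "m \<in># laplacian_spectrum G"
    using eigenvalue_in_laplacian_spectrum[OF vs ev u(1)] u_pos by simp
  moreover have "0 \<in># laplacian_spectrum G"
    using eigenvalue_in_laplacian_spectrum[OF vs, of "\<lambda>_. 1" 0 x] row xy by simp
  ultimately have "algebraic_connectivity G \<le> m"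
    unfolding algebraic_connectivity_def using m_pos by (intro second_smallest_le)
  then have "algebraic_connectivity G * (\<Sum>v\<in>?V. (f v)\<^sup>2) \<le> m * (\<Sum>v\<in>?V. (f v)\<^sup>2)"
    by (intro mult_right_mono sum_nonneg) auto
  also have "\<dots> \<le> bilin_form ?V ?A f f" using min[OF f0] by (simp add: m_def)
  also have "\<dots> = (\<Sum>v\<in>?V. f v * (\<Sum>w\<in>nbrs G v. f v - f w))"
    unfolding bilin_form_def by (intro sum.cong refl) (simp add: laplacian_kernel_sum)
  finally show ?thesis .
qed

section \<open>The radial profile\<close>

text \<open>
  The radial solution \<open>a j = b j / s ^ j\<close> of the eigenvalue equation on the \<open>d\<close>-regular tree, where
  \<open>b\<close> solves \<open>b j + b (j + 2) = 2 cos \<theta> b (j + 1)\<close> with initial values dictated by the root. The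
  equation for \<open>\<theta>\<close>, cleared of denominators, is the boundary condition \<open>b K = - s b (K - 1)\<close>.

  Positivity is a discrete Sturm comparison with the solution \<open>sin (j \<theta>)\<close>, which is positive for
  \<open>0 < j \<le> K\<close>: the Wronskian of the two is explicit and positive. The boundary condition makes
  \<open>b (K - 1)\<close> positive, and comparison with \<open>b (K - 1)\<close> does the rest. Monotonicity then follows from
  the recurrence, in which \<open>d - 2 s cos \<theta> > 0\<close>.
\<close>
lemma radial_profile:
  fixes d K :: nat and \<theta> :: real
  defines "s \<equiv> sqrt (real d - 1)"
  assumes d: "d \<ge> 3" and K: "K \<ge> 2" and th: "0 < \<theta>" "\<theta> * K < pi"
    and root: "(2 * s * cos \<theta> + d) * sin \<theta> * cos (\<theta> * K)
      + (s * (d - 2 * (cos \<theta>)\<^sup>2) + (real d - 2) * cos \<theta>) * sin (\<theta> * K) = 0"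
  obtains a :: "nat \<Rightarrow> real" where
    "\<And>j. j < K \<Longrightarrow> a j > 0" "\<And>j. j < K \<Longrightarrow> a (Suc j) < a j" "a K = - a (K - 1)"
    "2 * s * cos \<theta> * a 0 = d * a 1"
    "\<And>j. 2 * s * cos \<theta> * a (Suc j) = a j + (real d - 1) * a (Suc (Suc j))"
proof -
  let ?c = "cos \<theta>" and ?\<sigma> = "sin \<theta>"
  have s: "s\<^sup>2 = real d - 1" "s * s = real d - 1" "s > 1" using d by (auto simp: s_def)
  have thK: "\<theta> * 2 \<le> \<theta> * K" using K th(1) by (intro mult_left_mono) auto
  then have "\<theta> * 2 < pi" using th(2) by linarith
  then have c: "?c > 0" and \<sigma>: "?\<sigma> > 0"
    using th(1) by (auto intro!: cos_gt_zero sin_gt_zero)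
  have c1: "?c < 1" using th(1) \<open>\<theta> * 2 < pi\<close> cos_monotone_0_pi[of 0 \<theta>] by simp
  define b where "b j = d * ?\<sigma> * cos (\<theta> * real j) + (real d - 2) * ?c * sin (\<theta> * real j)" for j :: nat
  have wronsk: "b i * sin (\<theta> * j) - b j * sin (\<theta> * i) = d * ?\<sigma> * sin (\<theta> * j - \<theta> * i)" for i j :: nat
    unfolding b_def sin_diff by (simp add: algebra_simps)
  have b_rec: "2 * ?c * b (Suc j) = b j + b (Suc (Suc j))" for j
  proof -
    define t where "t = \<theta> * real (Suc j)"
    have t: "\<theta> * real j = t - \<theta>" "\<theta> * real (Suc (Suc j)) = t + \<theta>"
      by (auto simp: t_def algebra_simps)
    show ?thesis
      unfolding b_def t t_def[symmetric] cos_diff cos_add sin_diff sin_add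
      by (simp add: algebra_simps)
  qed
  have bK: "b K = - s * b (K - 1)"
  proof -
    define t where "t = \<theta> * real K"
    have t': "\<theta> * real (K - 1) = t - \<theta>" using K by (simp add: t_def algebra_simps of_nat_diff)
    have sq: "real d * (sin \<theta> * sin \<theta>) + (real d - 2) * (cos \<theta>)\<^sup>2 = d - 2 * (cos \<theta>)\<^sup>2"
      unfolding power2_eq_square[of "sin \<theta>", symmetric] sin_squared_eq by (simp add: algebra_simps)
    have "b K + s * b (K - 1) = (2 * s * cos \<theta> + d) * sin \<theta> * cos t
      + (s * (d - 2 * (cos \<theta>)\<^sup>2) + (real d - 2) * cos \<theta>) * sin t"
      unfolding b_def t' t_def[symmetric] sin_diff cos_diff sq[symmetric]
      by (simp add: power2_eq_square algebra_simps)
    then show ?thesis using root by (simp add: t_def)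
  qed
  have sin_pos: "sin (\<theta> * j) > 0" if "0 < j" "j \<le> K" for j :: nat
  proof (rule sin_gt_zero)
    show "0 < \<theta> * j" using that th by simp
    have "\<theta> * j \<le> \<theta> * K" using that th by (intro mult_left_mono) auto
    then show "\<theta> * j < pi" using th(2) by linarith
  qed
  have b_last: "b (K - 1) > 0"
  proof -
    have "b (K - 1) * sin (\<theta> * K) - b K * sin (\<theta> * real (K - 1)) = d * ?\<sigma> * ?\<sigma>"
      unfolding wronsk using K by (simp add: algebra_simps of_nat_diff)
    then have "b (K - 1) * (sin (\<theta> * K) + s * sin (\<theta> * real (K - 1))) = d * ?\<sigma> * ?\<sigma>"
      using bK by (simp add: algebra_simps)
    moreover have "sin (\<theta> * K) + s * sin (\<theta> * real (K - 1)) > 0"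
      using sin_pos[of K] sin_pos[of "K - 1"] K s by (simp add: add_pos_pos)
    ultimately show ?thesis using \<sigma> d
      by (metis mult_pos_pos of_nat_0_less_iff zero_less_mult_pos2 gr0I not_numeral_le_zero)
  qed
  have b_pos: "b j > 0" if "j < K" for j
  proof (cases "j = K - 1")
    case False
    then have j: "j < K - 1" using that by simp
    have "0 < sin (\<theta> * real (K - 1 - j))" using j by (intro sin_pos) auto
    then have "0 < d * ?\<sigma> * sin (\<theta> * real (K - 1 - j))" using \<sigma> d by simp
    also have "\<dots> = b j * sin (\<theta> * real (K - 1)) - b (K - 1) * sin (\<theta> * j)"
      unfolding wronsk using j by (simp add: of_nat_diff algebra_simps)
    also have "\<dots> \<le> b j * sin (\<theta> * real (K - 1))"
      using b_last sin_pos[of j] j by (cases "j = 0") (auto simp: less_imp_le)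
    finally show ?thesis using sin_pos[of "K - 1"] K
      by (simp add: zero_less_mult_iff)
  qed (use b_last in simp)
  define a where "a j = b j / s ^ j" for j
  have a0: "2 * s * ?c * a 0 = d * a 1"
  proof -
    have "b 1 = 2 * (s * s) * ?c * ?\<sigma>" unfolding s(2) by (simp add: b_def algebra_simps)
    moreover have "b 0 = d * ?\<sigma>" by (simp add: b_def)
    ultimately have "2 * s * ?c * b 0 * s = d * b 1" by simp
    then show ?thesis using s(3) by (simp add: a_def field_simps)
  qed
  have a_rec: "2 * s * ?c * a (Suc j) = a j + (real d - 1) * a (Suc (Suc j))" for j
  proof -
    have "2 * s * ?c * a (Suc j) = 2 * ?c * b (Suc j) / s ^ j"
      using s(3) by (simp add: a_def)
    also have "\<dots> = b j / s ^ j + b (Suc (Suc j)) / s ^ j"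
      unfolding b_rec add_divide_distrib ..
    also have "b (Suc (Suc j)) / s ^ j = (s * s) * a (Suc (Suc j))"
      using s(3) by (simp add: a_def)
    finally show ?thesis unfolding s(2) by (simp add: a_def)
  qed
  have a_pos: "a j > 0" if "j < K" for j
    using b_pos[OF that] s by (simp add: a_def)
  have gap: "2 * s * ?c < d"
  proof -
    have "0 \<le> (s - 1)\<^sup>2" by simp
    then have "2 * s \<le> d" unfolding power2_diff s(1) by simp
    moreover have "2 * s * ?c < 2 * s" using c1 s by simp
    ultimately show ?thesis by linarith
  qed
  show thesis
  proof (rule that)
    show "a K = - a (K - 1)"
    proof -
      have "s ^ K = s * s ^ (K - 1)" using K by (metis power_eq_if not_numeral_le_zero)
      then show ?thesis using s bK by (simp add: a_def)
    qed
    show "a (Suc j) < a j" if "j < K" for j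
      using that
    proof (induction j)
      case 0
      have "d * a 1 < d * a 0" using a0 gap a_pos[OF 0] by (metis mult_strict_right_mono)
      then show ?case using d by simp
    next
      case (Suc j)
      have "(real d - 1) * (a (Suc j) - a (Suc (Suc j))) = (d - 2 * s * ?c) * a (Suc j) + (a j - a (Suc j))"
        using a_rec[of j] by (simp add: algebra_simps)
      also have "\<dots> > 0" using gap a_pos[OF Suc.prems] Suc by (intro add_pos_pos mult_pos_pos) auto
      finally show ?case using d by (simp add: zero_less_mult_iff)
    qed
  qed (use a_pos a0 a_rec in auto)
qed

text \<open>
  With \<open>N\<close> and \<open>Q\<close> the numerator and denominator of the equation, the function
  \<open>\<Phi> t = N t cos (t K) + Q t sin (t K)\<close> is positive at \<open>pi / (2 K)\<close> and negative at \<open>pi / K\<close>. As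
  \<open>Q > 0\<close> in between, a zero of \<open>\<Phi>\<close> there is a root of the equation, so the smallest root is not
  larger.
\<close>
lemma smallest_theta_root_bounds:
  fixes d K :: nat and \<theta> :: real
  defines "s \<equiv> sqrt (real d - 1)"
  assumes d: "d \<ge> 3" and K: "K \<ge> 2" and sm: "smallest_pos_theta_root d K \<theta>"
  shows "\<theta> * K < pi"
    and "(2 * s * cos \<theta> + d) * sin \<theta> * cos (\<theta> * K)
      + (s * (d - 2 * (cos \<theta>)\<^sup>2) + (real d - 2) * cos \<theta>) * sin (\<theta> * K) = 0"
proof -
  define N where "N t = (2 * s * cos t + d) * sin t" for t
  define Q where "Q t = s * (d - 2 * (cos t)\<^sup>2) + (real d - 2) * cos t" for t
  define \<Phi> where "\<Phi> t = N t * cos (t * K) + Q t * sin (t * K)" for t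
  have s: "s > 1" using d by (auto simp: s_def)
  have root: "theta_root d K t \<longleftrightarrow> cos (t * K) \<noteq> 0 \<and> Q t \<noteq> 0 \<and> tan (t * K) = - (N t / Q t)" for t
    by (simp add: theta_root_def N_def Q_def s_def)
  have root_\<Phi>: "\<Phi> t = 0" if "theta_root d K t" for t
    using that unfolding root \<Phi>_def tan_def by (auto simp: field_simps)
  show "(2 * s * cos \<theta> + d) * sin \<theta> * cos (\<theta> * K)
      + (s * (d - 2 * (cos \<theta>)\<^sup>2) + (real d - 2) * cos \<theta>) * sin (\<theta> * K) = 0"
    using root_\<Phi>[of \<theta>] sm by (simp add: smallest_pos_theta_root_def \<Phi>_def N_def Q_def)
  have Q_pos: "Q t > 0" if "0 \<le> cos t" for t
  proof -
    have "(cos t)\<^sup>2 \<le> 1" by (simp add: abs_square_le_1)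
    then have "0 < d - 2 * (cos t)\<^sup>2" using d by linarith
    then show ?thesis using s d that unfolding Q_def by (intro add_pos_nonneg mult_pos_pos mult_nonneg_nonneg) auto
  qed
  define l where "l = pi / (2 * real K)"
  define u where "u = pi / real K"
  have lu: "0 < l" "l < u" "u \<le> pi / 2" "l * K = pi / 2" "u * K = pi"
    using K by (auto simp: l_def u_def field_simps)
  have c_nonneg: "0 \<le> cos t" if "l \<le> t" "t \<le> u" for t
    using lu that by (intro cos_ge_zero) auto
  have "\<Phi> l > 0" unfolding \<Phi>_def lu(4) using Q_pos[OF c_nonneg[of l]] lu(2) by simp
  moreover have "\<Phi> u < 0"
  proof -
    have "sin u > 0" using lu by (intro sin_gt_zero) auto
    moreover have "2 * s * cos u + d > 0" using c_nonneg[of u] lu s d by (simp add: add_nonneg_pos)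
    ultimately show ?thesis using lu by (simp add: \<Phi>_def N_def)
  qed
  moreover have "continuous_on {l..u} \<Phi>"
    unfolding \<Phi>_def N_def Q_def by (intro continuous_intros)
  ultimately obtain t where t: "l \<le> t" "t \<le> u" "\<Phi> t = 0"
    using IVT2'[of \<Phi> u 0 l] lu by (auto simp: less_imp_le)
  have tu: "t < u" using t \<open>\<Phi> u < 0\<close> by (cases "t = u") auto
  have tK: "t * K < pi" using tu K lu(5) mult_strict_right_mono[OF tu, of "real K"] by simp
  have "cos (t * K) \<noteq> 0"
  proof
    assume c: "cos (t * K) = 0"
    have "0 < t * K" using t lu K by simp
    then have "sin (t * K) > 0" using tK by (intro sin_gt_zero)
    then show False using t(3) c Q_pos[OF c_nonneg[OF t(1,2)]] by (simp add: \<Phi>_def)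
  qed
  moreover have "Q t \<noteq> 0" using Q_pos[OF c_nonneg[OF t(1,2)]] by simp
  ultimately have "theta_root d K t"
    using t(3) unfolding root \<Phi>_def tan_def by (simp add: field_simps)
  then have "\<theta> \<le> t" using sm t lu by (simp add: smallest_pos_theta_root_def)
  then have "\<theta> * K \<le> t * K" by (simp add: mult_right_mono)
  then show "\<theta> * K < pi" using tK by linarith
qed

text \<open>
  With \<open>s = sqrt (d - 1)\<close>, clearing denominators turns the equation for \<open>K = 1\<close> into
  \<open>sin \<theta> (s d + 2 s\<^sup>2 cos \<theta>) = 0\<close>. The second factor is positive because \<open>d > 2 s\<close>, so the
  smallest root is \<open>pi\<close>.
\<close>
lemma smallest_theta_root_1:
  fixes d :: nat and \<theta> :: real
  assumes d: "d \<ge> 3" and sm: "smallest_pos_theta_root d 1 \<theta>"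
  shows "cos \<theta> = - 1"
proof -
  define s where "s = sqrt (real d - 1)"
  have s: "s > 1" "s * s = real d - 1" using d by (auto simp: s_def)
  have "0 < (s - 1) * (s - 1)" using s by simp
  then have ds: "2 * s < d" using s(2) by (simp add: algebra_simps)
  have "theta_root d 1 pi"
  proof -
    have "0 < (real d - 2) * (s - 1)" using s d by simp
    moreover have "(real d - 2) * (s - 1) = s * (real d - 2) - (real d - 2)"
      by (simp add: algebra_simps)
    ultimately have nz: "s * (real d - 2) - (real d - 2) \<noteq> 0" by linarith
    show ?thesis by (simp add: theta_root_def flip: s_def) (insert nz, linarith)
  qed
  then have "0 < \<theta>" "\<theta> \<le> pi" and r: "theta_root d 1 \<theta>"
    using sm by (auto simp: smallest_pos_theta_root_def)
  define Q where "Q = s * (d - 2 * (cos \<theta>)\<^sup>2) + (real d - 2) * cos \<theta>"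
  have Q: "Q \<noteq> 0" "cos \<theta> \<noteq> 0" "sin \<theta> / cos \<theta> = - ((2 * s * cos \<theta> + d) * sin \<theta> / Q)"
    using r by (simp_all add: theta_root_def s_def[symmetric] Q_def[symmetric] tan_def)
  then have "sin \<theta> * (Q + (2 * s * cos \<theta> + d) * cos \<theta>) = 0" by (simp add: field_simps)
  moreover have "Q + (2 * s * cos \<theta> + d) * cos \<theta> = s * d + 2 * (s * s) * cos \<theta>"
    unfolding s(2) Q_def by (simp add: algebra_simps power2_eq_square)
  moreover have "s * d + 2 * (s * s) * cos \<theta> > 0"
  proof -
    have "- (2 * s) \<le> 2 * s * cos \<theta>" using s(1) mult_left_mono[OF cos_ge_minus_one[of \<theta>], of "2 * s"] by simp
    then have "0 < d + 2 * s * cos \<theta>" using ds by linarith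
    then have "0 < s * (d + 2 * s * cos \<theta>)" using s by simp
    then show ?thesis by (simp add: algebra_simps)
  qed
  ultimately have "sin \<theta> = 0" by simp
  then have "\<theta> = pi" using \<open>0 < \<theta>\<close> \<open>\<theta> \<le> pi\<close> sin_gt_zero[of \<theta>] by fastforce
  then show ?thesis by simp
qed

section \<open>The test function on two disjoint balls\<close>

text \<open>
  Here \<open>p\<close> and \<open>q\<close> are the distances from \<open>x\<close> and \<open>y\<close>. Keeping both as parameters makes the
  situation symmetric, so that each statement about the ball around \<open>x\<close> also serves for \<open>y\<close>.
\<close>
locale ball_pair = G: pair_graph G for G :: "'a pair_pre_digraph" +
  fixes d K :: nat and x y :: 'a and p q :: "'a \<Rightarrow> nat"
  assumes deg: "v \<in> pverts G \<Longrightarrow> card (nbrs G v) = d"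
    and d3: "d \<ge> 3" and K2: "K \<ge> 2"
    and p_level: "level_function G x p" and q_level: "level_function G y q"
    and far: "v \<in> pverts G \<Longrightarrow> 2 * K - 1 \<le> p v + q v"
begin

sublocale P: level_function G x p by (rule p_level)
sublocale Q: level_function G y q by (rule q_level)

lemma swap: "ball_pair G d K y x q p"
  by unfold_locales (use deg d3 K2 far in \<open>auto simp: add.commute\<close>)

lemma not_both: "v \<in> pverts G \<Longrightarrow> p v < K \<Longrightarrow> K \<le> q v"
  using far[of v] by linarith

lemma nbr_levels:
  assumes "w \<in> nbrs G v"
  shows "p w \<le> Suc (p v)" "p v \<le> Suc (p w)"
  using assms P.lev_step[of v w] P.lev_step[of w v] G.nbrs_sym[of w v] by (auto simp: nbrs_def)

text \<open>
  The equality case of the neighbour sum bound at a vertex of the ball around \<open>x\<close>. The condition on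
  \<open>p w = K\<close> concerns vertices \<open>v\<close> on the boundary of the ball, whose outward neighbours have to lie on
  the boundary of the ball around \<open>y\<close>.
\<close>
definition tight :: "'a \<Rightarrow> bool" where
  "tight v \<longleftrightarrow> (\<forall>w\<in>nbrs G v. p w \<noteq> p v \<and> (p w = K \<longrightarrow> q w = K - 1)) \<and>
     (\<forall>w\<in>nbrs G v. \<forall>w'\<in>nbrs G v. p w < p v \<and> p w' < p v \<longrightarrow> w = w')"

text \<open>
  Apart from one neighbour at the lower level (none for \<open>v = x\<close>), each neighbour contributes at least
  \<open>a (Suc (p v))\<close>. For \<open>p v = K - 1\<close> this number is \<open>a K = - a (K - 1)\<close>, exactly what a neighbour on the
  boundary of the other ball contributes. So the recurrence gives the bound, and in case of
  equality all those contributions are minimal.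
\<close>
lemma tight_sum:
  fixes a :: "nat \<Rightarrow> real"
  assumes pos: "\<And>j. j < K \<Longrightarrow> a j > 0" and dec: "\<And>j. j < K \<Longrightarrow> a (Suc j) < a j"
    and last: "a K = - a (K - 1)"
    and rec0: "\<mu> * a 0 = d * a 1"
    and rec: "\<And>j. \<mu> * a (Suc j) = a j + (real d - 1) * a (Suc (Suc j))"
    and v: "v \<in> pverts G" "p v < K"
  defines "h \<equiv> \<lambda>w. (if p w < K then a (p w) else 0) - (if q w < K then a (q w) else 0)"
  shows "\<mu> * a (p v) \<le> (\<Sum>w\<in>nbrs G v. h w)"
    and "(\<Sum>w\<in>nbrs G v. h w) = \<mu> * a (p v) \<Longrightarrow> tight v"
proof -
  define c where "c = a (Suc (p v))"
  have h_ge: "c \<le> h w" and h_eq: "h w = c \<Longrightarrow> p w = Suc (p v) \<and> (p w = K \<longrightarrow> q w = K - 1)"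
    if w: "w \<in> nbrs G v" for w
  proof -
    have wv: "w \<in> pverts G" using G.nbrs_in_verts that by blast
    have mono: "a j < a i" if "i < j" "j \<le> K" for i j
      using that
    proof (induction j)
      case (Suc j)
      then show ?case using dec[of j] by (cases "i = j") auto
    qed simp
    have "c \<le> h w \<and> (h w = c \<longrightarrow> p w = Suc (p v) \<and> (p w = K \<longrightarrow> q w = K - 1))"
    proof (cases "p w < K")
      case True
      then have hw: "h w = a (p w)" using not_both[OF wv] by (simp add: h_def)
      show ?thesis
      proof (cases "p w = Suc (p v)")
        case False
        then have "p w < Suc (p v)" using nbr_levels[OF w] by simp
        then have "c < h w" unfolding hw c_def using v by (intro mono) auto
        then show ?thesis by simp
      qed (use True hw in \<open>simp add: c_def\<close>)
    next
      case False
      then have pw: "p w = K" "Suc (p v) = K" using nbr_levels[OF w] v by auto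
      have qw: "K - 1 \<le> q w" using far[OF wv] pw K2 by linarith
      have c: "c = - a (K - 1)" using pw last by (simp add: c_def)
      show ?thesis
      proof (cases "q w < K")
        case True
        then have "q w = K - 1" using qw by simp
        then show ?thesis using pw c K2 by (simp add: h_def)
      next
        case False
        then show ?thesis using pw c pos[of "K - 1"] K2 by (simp add: h_def)
      qed
    qed
    then show "c \<le> h w" "h w = c \<Longrightarrow> p w = Suc (p v) \<and> (p w = K \<longrightarrow> q w = K - 1)" by auto
  qed
  have "\<mu> * a (p v) \<le> (\<Sum>w\<in>nbrs G v. h w) \<and> ((\<Sum>w\<in>nbrs G v. h w) = \<mu> * a (p v) \<longrightarrow> tight v)"
  proof (cases "p v")
    case 0
    have "(\<Sum>w\<in>nbrs G v. c) = \<mu> * a (p v)" using rec0 deg[OF v(1)] 0 by (simp add: c_def)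
    then have *: "(\<Sum>w\<in>nbrs G v. h w) - \<mu> * a (p v) = (\<Sum>w\<in>nbrs G v. h w - c)"
      by (simp add: sum_subtractf)
    have "0 \<le> (\<Sum>w\<in>nbrs G v. h w - c)" using h_ge by (intro sum_nonneg) simp
    moreover have "tight v" if "(\<Sum>w\<in>nbrs G v. h w - c) = 0"
    proof -
      have "\<forall>w\<in>nbrs G v. h w - c = 0"
        using that h_ge sum_nonneg_eq_0_iff[OF G.finite_nbrs, of v "\<lambda>w. h w - c"] by simp
      then show ?thesis using h_eq 0 unfolding tight_def by fastforce
    qed
    ultimately show ?thesis using * by auto
  next
    case (Suc j)
    then have "v \<noteq> x" using P.lev_root by auto
    then obtain u where u: "u \<in> nbrs G v" "p v = Suc (p u)"
      using P.lev_pred v(1) G.nbrs_sym[of _ v] by (auto simp: nbrs_def)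
    then have pu: "p u = j" using Suc by simp
    have hu: "h u = a j"
      using pu Suc v not_both[of u] G.nbrs_in_verts(1)[OF u(1)] by (simp add: h_def)
    let ?N = "nbrs G v - {u}"
    have card: "real (card ?N) = real d - 1" using deg[OF v(1)] u d3 by (simp add: of_nat_diff)
    have "\<mu> * a (p v) = a j + (real d - 1) * c" using rec[of j] Suc by (simp add: c_def)
    moreover have "(\<Sum>w\<in>nbrs G v. h w) = h u + (\<Sum>w\<in>?N. h w)" using u by (simp add: sum.remove)
    ultimately have *: "(\<Sum>w\<in>nbrs G v. h w) - \<mu> * a (p v) = (\<Sum>w\<in>?N. h w - c)"
      using hu unfolding sum_subtractf sum_constant card by linarith
    have "0 \<le> (\<Sum>w\<in>?N. h w - c)" using h_ge by (intro sum_nonneg) simp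
    moreover have "tight v" if "(\<Sum>w\<in>?N. h w - c) = 0"
    proof -
      have "\<forall>w\<in>?N. h w - c = 0"
        using that h_ge sum_nonneg_eq_0_iff[of ?N "\<lambda>w. h w - c"] by simp
      then have N: "p w = Suc (p v) \<and> (p w = K \<longrightarrow> q w = K - 1)" if "w \<in> ?N" for w
        using h_eq that by auto
      have pu': "p u \<noteq> K" "p u \<noteq> p v" using pu Suc v by auto
      show ?thesis unfolding tight_def
      proof (intro conjI ballI impI)
        fix w assume "w \<in> nbrs G v"
        then show "p w \<noteq> p v" "p w = K \<Longrightarrow> q w = K - 1" using N[of w] pu' by (cases "w = u"; auto)+
      next
        fix w w' assume "w \<in> nbrs G v" "w' \<in> nbrs G v" "p w < p v \<and> p w' < p v"
        then show "w = w'" using N[of w] N[of w'] by (cases "w = u"; cases "w' = u") auto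
      qed
    qed
    ultimately show ?thesis using * by auto
  qed
  then show "\<mu> * a (p v) \<le> (\<Sum>w\<in>nbrs G v. h w)" "(\<Sum>w\<in>nbrs G v. h w) = \<mu> * a (p v) \<Longrightarrow> tight v"
    by auto
qed

end

text \<open>
  Let \<open>A\<close> be the adjacency operator and \<open>C\<close> the inner product of \<open>f\<close> with \<open>A h\<close>. Since \<open>f\<close> and \<open>h\<close> have
  disjoint supports and \<open>A\<close> is symmetric, the energy of \<open>e = \<alpha> f - \<beta> h\<close> with respect to \<open>A - \<mu>\<close> is
  \<open>\<alpha>\<^sup>2 (\<Sum> Sf) + \<beta>\<^sup>2 (\<Sum> Sh) + (\<alpha> - \<beta>)\<^sup>2 C\<close>. The terms \<open>Sf v\<close> and \<open>Sh v\<close> are the slacks in \<open>tight_sum\<close>,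
  weighted by \<open>f v\<close> and \<open>h v\<close>, so all three parts are nonnegative; the Rayleigh bound forces them to
  vanish.
\<close>
lemma (in ball_pair) tight_of_rayleigh:
  fixes a :: "nat \<Rightarrow> real"
  assumes pos: "\<And>j. j < K \<Longrightarrow> a j > 0" and dec: "\<And>j. j < K \<Longrightarrow> a (Suc j) < a j"
    and last: "a K = - a (K - 1)"
    and rec0: "\<mu> * a 0 = d * a 1"
    and rec: "\<And>j. \<mu> * a (Suc j) = a j + (real d - 1) * a (Suc (Suc j))"
    and rayleigh: "\<And>f :: 'a \<Rightarrow> real. (\<Sum>v\<in>pverts G. f v) = 0 \<Longrightarrow>
      (\<Sum>v\<in>pverts G. f v * (\<Sum>w\<in>nbrs G v. f w)) \<le> \<mu> * (\<Sum>v\<in>pverts G. (f v)\<^sup>2)"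
  shows "\<And>v. v \<in> pverts G \<Longrightarrow> p v < K \<Longrightarrow> tight v"
    and "\<And>v. v \<in> pverts G \<Longrightarrow> q v < K \<Longrightarrow> ball_pair.tight G K q p v"
proof -
  interpret S: ball_pair G d K y x q p by (rule swap)
  let ?V = "pverts G"
  define f where "f v = (if p v < K then a (p v) else 0)" for v
  define h where "h v = (if q v < K then a (q v) else 0)" for v
  define A where "A u v = (\<Sum>w\<in>nbrs G v. u w)" for u :: "'a \<Rightarrow> real" and v
  define Sf where "Sf v = f v * (A f v - A h v - \<mu> * f v)" for v
  define Sh where "Sh v = h v * (A h v - A f v - \<mu> * h v)" for v
  note profile = pos dec last rec0 rec
  have diff: "A f v - A h v = (\<Sum>w\<in>nbrs G v. (if p w < K then a (p w) else 0) - (if q w < K then a (q w) else 0))"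
    "A h v - A f v = (\<Sum>w\<in>nbrs G v. (if q w < K then a (q w) else 0) - (if p w < K then a (p w) else 0))" for v
    by (simp_all add: A_def f_def h_def sum_subtractf)
  have Sf: "0 \<le> Sf v" "Sf v = 0 \<Longrightarrow> p v < K \<Longrightarrow> tight v" if "v \<in> ?V" for v
    using tight_sum[OF profile that] pos[of "p v"] unfolding Sf_def diff by (auto simp: f_def)
  have Sh: "0 \<le> Sh v" "Sh v = 0 \<Longrightarrow> q v < K \<Longrightarrow> S.tight v" if "v \<in> ?V" for v
    using S.tight_sum[OF profile that] pos[of "q v"] unfolding Sh_def diff by (auto simp: h_def)
  have fh: "f v * h v = 0" if "v \<in> ?V" for v
    using not_both[OF that] by (auto simp: f_def h_def)
  define C where "C = (\<Sum>v\<in>?V. f v * A h v)"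
  have A_adj: "A u v = (\<Sum>w\<in>?V. (if (v, w) \<in> parcs G then 1 else 0) * u w)" for u v
  proof -
    have "A u v = (\<Sum>w\<in>?V \<inter> nbrs G v. u w)"
      unfolding A_def using G.nbrs_in_verts by (intro sum.cong) auto
    then show ?thesis using G.pair_finite_verts
      by (simp add: sum.inter_restrict nbrs_def if_distrib[where f="\<lambda>c. c * _"] cong: if_cong)
  qed
  have C': "(\<Sum>v\<in>?V. h v * A f v) = C"
    using bilin_form_commute[of "\<lambda>v w. if (v, w) \<in> parcs G then 1 else 0" ?V h f] G.arcs_symmetric
    unfolding C_def bilin_form_def A_adj by meson
  have nonneg: "f v \<ge> 0" "h v \<ge> 0" for v using pos by (auto simp: f_def h_def less_imp_le)
  then have "C \<ge> 0" unfolding C_def A_def by (intro sum_nonneg mult_nonneg_nonneg) auto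
  \<comment> \<open>These weights give \<open>\<alpha> f - \<beta> h\<close> mean \<open>0\<close>.\<close>
  define \<alpha> where "\<alpha> = (\<Sum>v\<in>?V. h v)"
  define \<beta> where "\<beta> = (\<Sum>v\<in>?V. f v)"
  have "\<alpha> > 0"
    unfolding \<alpha>_def using pos[of 0] K2 Q.root Q.lev_root nonneg G.pair_finite_verts
    by (intro sum_pos2[of _ y]) (auto simp: h_def)
  have "\<beta> > 0"
    unfolding \<beta>_def using pos[of 0] K2 P.root P.lev_root nonneg G.pair_finite_verts
    by (intro sum_pos2[of _ x]) (auto simp: f_def)
  define e where "e v = \<alpha> * f v - \<beta> * h v" for v
  have "(\<Sum>v\<in>?V. e v) = 0"
    by (simp add: e_def sum_subtractf \<alpha>_def \<beta>_def flip: sum_distrib_left)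
  from rayleigh[OF this] have "(\<Sum>v\<in>?V. e v * (A e v - \<mu> * e v)) \<le> 0"
    by (simp add: A_def algebra_simps power2_eq_square sum_subtractf sum_distrib_left)
  also have "(\<Sum>v\<in>?V. e v * (A e v - \<mu> * e v))
      = (\<Sum>v\<in>?V. \<alpha>\<^sup>2 * Sf v + \<beta>\<^sup>2 * Sh v + (\<alpha>\<^sup>2 - \<alpha> * \<beta>) * (f v * A h v) + (\<beta>\<^sup>2 - \<alpha> * \<beta>) * (h v * A f v))"
  proof (intro sum.cong refl)
    fix v assume "v \<in> ?V"
    have Ae: "A e v = \<alpha> * A f v - \<beta> * A h v"
      by (simp add: A_def e_def sum_subtractf sum_distrib_left)
    have ev: "e v = \<alpha> * f v - \<beta> * h v" by (simp add: e_def)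
    have "f v = 0 \<or> h v = 0" using fh[OF \<open>v \<in> ?V\<close>] by simp
    then show "e v * (A e v - \<mu> * e v) = \<alpha>\<^sup>2 * Sf v + \<beta>\<^sup>2 * Sh v
        + (\<alpha>\<^sup>2 - \<alpha> * \<beta>) * (f v * A h v) + (\<beta>\<^sup>2 - \<alpha> * \<beta>) * (h v * A f v)"
      unfolding Sf_def Sh_def Ae ev
      by (elim disjE) (simp_all add: power2_eq_square algebra_simps)
  qed
  also have "\<dots> = \<alpha>\<^sup>2 * (\<Sum>v\<in>?V. Sf v) + \<beta>\<^sup>2 * (\<Sum>v\<in>?V. Sh v) + (\<alpha> - \<beta>)\<^sup>2 * C"
    unfolding sum.distrib sum_distrib_left[symmetric] C' C_def[symmetric]
    by (simp add: power2_eq_square algebra_simps)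
  finally have le: "\<alpha>\<^sup>2 * (\<Sum>v\<in>?V. Sf v) + \<beta>\<^sup>2 * (\<Sum>v\<in>?V. Sh v) + (\<alpha> - \<beta>)\<^sup>2 * C \<le> 0" .
  have nn: "(\<Sum>v\<in>?V. Sf v) \<ge> 0" "(\<Sum>v\<in>?V. Sh v) \<ge> 0" using Sf(1) Sh(1) by (auto intro: sum_nonneg)
  have "\<alpha>\<^sup>2 * (\<Sum>v\<in>?V. Sf v) = 0 \<and> \<beta>\<^sup>2 * (\<Sum>v\<in>?V. Sh v) = 0"
    using le mult_nonneg_nonneg[OF zero_le_power2[of \<alpha>] nn(1)] mult_nonneg_nonneg[OF zero_le_power2[of \<beta>] nn(2)]
      mult_nonneg_nonneg[OF zero_le_power2[of "\<alpha> - \<beta>"] \<open>C \<ge> 0\<close>] by linarith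
  then have "(\<Sum>v\<in>?V. Sf v) = 0" "(\<Sum>v\<in>?V. Sh v) = 0" using \<open>\<alpha> > 0\<close> \<open>\<beta> > 0\<close> by auto
  then have "\<forall>v\<in>?V. Sf v = 0" "\<forall>v\<in>?V. Sh v = 0"
    using sum_nonneg_eq_0_iff[OF G.pair_finite_verts] Sf(1) Sh(1) by metis+
  then show "\<And>v. v \<in> pverts G \<Longrightarrow> p v < K \<Longrightarrow> tight v"
    "\<And>v. v \<in> pverts G \<Longrightarrow> q v < K \<Longrightarrow> S.tight v"
    using Sf(2) Sh(2) by auto
qed

section \<open>Reading off the two Bethe trees\<close>

definition induced :: "'a pair_pre_digraph \<Rightarrow> 'a set \<Rightarrow> 'a pair_pre_digraph" where
  "induced G W = \<lparr>pverts = W, parcs = parcs G \<inter> W \<times> W\<rparr>"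

lemma (in pair_graph) pair_graph_induced:
  assumes "W \<subseteq> pverts G"
  shows "pair_graph (induced G W)"
proof unfold_locales
  show "finite (pverts (induced G W))" "finite (parcs (induced G W))"
    using assms pair_finite_verts pair_finite_arcs by (auto simp: induced_def intro: finite_subset)
  show "symmetric (with_proj (induced G W))"
    using arcs_symmetric by (auto simp: symmetric_def induced_def sym_def)
qed (auto simp: induced_def dest: no_loops')

locale tight_ball_pair = ball_pair +
  assumes all_tight: "v \<in> pverts G \<Longrightarrow> p v < K \<Longrightarrow> tight v"
    and all_tight': "v \<in> pverts G \<Longrightarrow> q v < K \<Longrightarrow> ball_pair.tight G K q p v"
begin

lemma swap_tight: "tight_ball_pair G d K y x q p"
proof -
  interpret S: ball_pair G d K y x q p by (rule swap)
  show ?thesis by unfold_locales (use all_tight all_tight' in auto)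
qed

definition ball :: "'a set" where "ball = {v \<in> pverts G. p v < K}"

definition up :: "'a \<Rightarrow> 'a set" where "up v = {w \<in> nbrs G v. p w = Suc (p v)}"

lemma ball_sub: "ball \<subseteq> pverts G" by (auto simp: ball_def)

lemma nbr_cases:
  assumes "v \<in> ball" "w \<in> nbrs G v"
  shows "p w = Suc (p v) \<or> p v = Suc (p w)"
  using all_tight[of v] nbr_levels[OF assms(2)] assms unfolding ball_def tight_def
  by (metis (mono_tags, lifting) le_SucE le_antisym mem_Collect_eq)

lemma unique_parent:
  assumes "v \<in> ball" "u \<in> nbrs G v" "w \<in> nbrs G v" "p u < p v" "p w < p v"
  shows "u = w"
  using all_tight[of v] assms unfolding ball_def tight_def by blast

lemma leaf_up:
  assumes "v \<in> ball" "Suc (p v) = K" "w \<in> up v"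
  shows "p w = K" "q w = K - 1"
  using all_tight[of v] assms unfolding ball_def tight_def up_def by auto

lemma card_up:
  assumes "v \<in> ball"
  shows "card (up v) = (if v = x then d else d - 1)"
proof (cases "v = x")
  case True
  then have "up v = nbrs G v"
    using nbr_cases[OF assms] P.lev_root by (fastforce simp: up_def)
  then show ?thesis using True deg P.root by simp
next
  case False
  have v: "v \<in> pverts G" using assms by (simp add: ball_def)
  then obtain u where u: "(u, v) \<in> parcs G" "p v = Suc (p u)" using P.lev_pred False by blast
  then have "u \<in> nbrs G v" by (simp add: nbrs_def G.arcs_symmetric)
  moreover have "up v = nbrs G v - {u}"
    using nbr_cases[OF assms] unique_parent[OF assms _ \<open>u \<in> nbrs G v\<close>] u by (fastforce simp: up_def)
  ultimately show ?thesis using deg[OF v] False by simp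
qed

lemma up_in_ball: "v \<in> ball \<Longrightarrow> Suc (p v) < K \<Longrightarrow> w \<in> up v \<Longrightarrow> w \<in> ball"
  using G.nbrs_in_verts by (auto simp: up_def ball_def)

abbreviation "T \<equiv> induced G ball"

lemma T_simps: "pverts T = ball" "parcs T = parcs G \<inter> ball \<times> ball"
  by (simp_all add: induced_def)

lemma x_ball: "x \<in> ball" using P.root P.lev_root K2 by (simp add: ball_def)

lemma T_level: "level_function T x p"
proof -
  interpret T: pair_graph T using G.pair_graph_induced[OF ball_sub] .
  show ?thesis
  proof unfold_locales
    show "x \<in> pverts T" using x_ball by (simp add: T_simps)
    show "p w \<le> Suc (p v)" if "(v, w) \<in> parcs T" for v w
      using that P.lev_step by (auto simp: T_simps)
    show "\<exists>w. (w, v) \<in> parcs T \<and> p v = Suc (p w)" if vT: "v \<in> pverts T" and vx: "v \<noteq> x" for v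
    proof -
      have "v \<in> ball" using vT by (simp add: T_simps)
      then have v: "v \<in> pverts G" "p v < K" by (auto simp: ball_def)
      then obtain w where w: "(w, v) \<in> parcs G" "p v = Suc (p w)" using P.lev_pred vx by blast
      then have "w \<in> ball" using v G.in_arcsD1[OF w(1)] by (simp add: ball_def)
      then show ?thesis using w \<open>v \<in> ball\<close> by (auto simp: T_simps)
    qed
  qed (rule P.lev_root)
qed

sublocale T: level_function T x p by (rule T_level)

lemma gdist_T: "v \<in> ball \<Longrightarrow> gdist T x v = p v"
  using T.gdist_eq_lev by (simp add: T_simps)

lemma children_T:
  assumes "v \<in> ball"
  shows "children T x v = (if Suc (p v) < K then up v else {})"
proof -
  have "children T x v = {w \<in> up v. w \<in> ball}"
    using assms gdist_T by (auto simp: children_def T_simps up_def nbrs_def)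
  then show ?thesis using up_in_ball[OF assms] by (auto simp: up_def ball_def)
qed

lemma leaves_T: "leaves T x = {v \<in> pverts G. p v = K - 1}"
proof -
  have "up v \<noteq> {}" if "v \<in> ball" for v
    using card_up[OF that] d3 by (auto split: if_splits)
  then have "leaves T x = {v \<in> ball. \<not> Suc (p v) < K}"
    unfolding leaves_def by (auto simp: T_simps children_T)
  also have "\<dots> = {v \<in> pverts G. p v = K - 1}"
    unfolding ball_def using K2 by fastforce
  finally show ?thesis .
qed

lemma leaf_iff: "v \<in> leaves T x \<longleftrightarrow> v \<in> ball \<and> Suc (p v) = K"
  unfolding leaves_T unfolding ball_def using K2 by fastforce

lemma bethe_tree_T: "bethe_tree d K T x"
  unfolding bethe_tree_def undirected_tree_def
proof (intro conjI ballI notI)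
  show "pair_graph T" by (rule T.pair_graph)
  show "connected T" by (rule T.connected_of_levels)
  show "x \<in> pverts T" by (rule T.root)
  show False if ex: "\<exists>c. pre_digraph.cycle T c \<and> 3 \<le> length c"
  proof -
    obtain c where c: "pre_digraph.cycle T c" "3 \<le> length c" using ex by blast
    have "length c < 3"
    proof (rule no_long_cycle[where lev = p, OF _ _ _ c(1)])
      show "pair_wf_digraph T" by unfold_locales
      show "p v \<noteq> p w" if "(v, w) \<in> parcs T" for v w
        using that nbr_cases[of v w] by (auto simp: T_simps nbrs_def)
      show "u = w" if "(u, v) \<in> parcs T" "(v, w) \<in> parcs T" "p u < p v" "p w < p v" for u v w
        using that unique_parent[of v u w] by (auto simp: T_simps nbrs_def G.arcs_symmetric)
    qed
    then show False using c(2) by simp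
  qed
  show "gdist T x v \<le> K - 1" if "v \<in> pverts T" for v
    using that by (simp add: T_simps gdist_T) (auto simp: ball_def)
  show "out_degree T v = d" if "v \<in> pverts T - leaves T x" for v
  proof -
    have v: "v \<in> ball" using that by (simp add: T_simps)
    then have vK: "Suc (p v) < K" using that ball_sub by (auto simp: leaves_T) (auto simp: ball_def)
    have "nbrs G v \<subseteq> ball"
      using nbr_levels(1)[of _ v] G.nbrs_in_verts(1)[of _ v] vK by (force simp: ball_def)
    then have "nbrs T v = nbrs G v" using v by (auto simp: nbrs_def T_simps)
    then show ?thesis using T.out_degree_nbrs deg v ball_sub by auto
  qed
  show "gdist T x v = K - 1" if "v \<in> leaves T x" for v
  proof -
    have v: "v \<in> pverts G" "p v = K - 1" using that by (auto simp: leaves_T)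
    then have "v \<in> ball" using K2 by (simp add: ball_def)
    then show ?thesis using gdist_T v by simp
  qed
qed

definition sphere :: "nat \<Rightarrow> 'a set" where "sphere j = {v \<in> pverts G. p v = j}"

lemma finite_sphere [simp]: "finite (sphere j)"
  using G.pair_finite_verts by (simp add: sphere_def)

lemma sphere_ball: "j < K \<Longrightarrow> v \<in> sphere j \<Longrightarrow> v \<in> ball"
  by (simp add: sphere_def ball_def)

text \<open>
  By uniqueness of the lower neighbour, a sphere is the disjoint union of the sets \<open>up v\<close> for \<open>v\<close> in
  the previous sphere.
\<close>
lemma card_sphere: "Suc j < K \<Longrightarrow> card (sphere (Suc j)) = d * (d - 1) ^ j"
proof (induction j)
  have s0: "sphere 0 = {x}" using P.lev_eq_0_iff P.root by (auto simp: sphere_def)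
  have step: "card (sphere (Suc j)) = (\<Sum>v\<in>sphere j. card (up v))" if j: "Suc j < K" for j
  proof -
    have "sphere (Suc j) = (\<Union>v\<in>sphere j. up v)"
    proof (intro equalityI subsetI)
      fix w assume w: "w \<in> sphere (Suc j)"
      then have "w \<noteq> x" "w \<in> pverts G" using P.lev_root by (auto simp: sphere_def)
      then obtain v where "(v, w) \<in> parcs G" "p w = Suc (p v)" using P.lev_pred by blast
      then show "w \<in> (\<Union>v\<in>sphere j. up v)"
        using w G.in_arcsD1 by (auto simp: sphere_def up_def nbrs_def)
    qed (auto simp: sphere_def up_def dest: G.nbrs_in_verts)
    moreover have "up v \<inter> up w = {}" if vw: "v \<in> sphere j" "w \<in> sphere j" "v \<noteq> w" for v w
    proof (rule ccontr)
      assume "up v \<inter> up w \<noteq> {}"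
      then obtain u where u: "u \<in> nbrs G v" "u \<in> nbrs G w" "p u = Suc j"
        using vw by (auto simp: up_def sphere_def)
      then have "u \<in> ball" using G.nbrs_in_verts(1) j by (auto simp: ball_def)
      then show False using unique_parent[of u v w] u vw G.nbrs_sym by (auto simp: sphere_def)
    qed
    moreover have "\<forall>v\<in>sphere j. finite (up v)" by (simp add: up_def)
    ultimately show ?thesis by (simp add: card_UN_disjoint)
  qed
  {
    case 0
    then show ?case using step[of 0] card_up[OF x_ball] s0 by simp
  next
    case (Suc j)
    have "card (up v) = d - 1" if "v \<in> sphere (Suc j)" for v
      using card_up[of v] that sphere_ball[OF _ that] Suc.prems P.lev_root by (auto simp: sphere_def)
    then show ?case using step[OF Suc.prems] Suc by simp
  }
qed

lemma card_leaves: "card (leaves T x) = d * (d - 1) ^ (K - 2)"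
proof -
  have "leaves T x = sphere (Suc (K - 2))"
    unfolding leaves_T sphere_def using K2 by (intro Collect_cong) auto
  then show ?thesis using card_sphere[of "K - 2"] K2 by simp
qed

lemma card_ball: "card ball = 1 + d * (\<Sum>j<K - 1. (d - 1) ^ j)"
proof -
  have ball: "ball = (\<Union>j\<in>{..<K}. sphere j)" by (auto simp: ball_def sphere_def)
  have "card ball = (\<Sum>j<K. card (sphere j))"
    unfolding ball by (rule card_UN_disjoint) (auto simp: sphere_def G.pair_finite_verts)
  also have "\<dots> = card (sphere 0) + (\<Sum>j<K - 1. card (sphere (Suc j)))"
    using sum.lessThan_Suc_shift[of "\<lambda>j. card (sphere j)" "K - 1"] K2 by simp
  also have "sphere 0 = {x}" using P.lev_eq_0_iff P.root by (auto simp: sphere_def)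
  also have "(\<Sum>j<K - 1. card (sphere (Suc j))) = (\<Sum>j<K - 1. d * (d - 1) ^ j)"
    by (intro sum.cong refl card_sphere) auto
  finally show ?thesis by (simp add: sum_distrib_left)
qed

text \<open>
  The ball around \<open>y\<close>, named here because the interpretation with \<open>x\<close> and \<open>y\<close> exchanged, which
  provides it as another \<open>ball\<close>, is made only below.
\<close>
definition other :: "'a set" where "other = {v \<in> pverts G. q v < K}"

lemma arc_out:
  assumes "(v, w) \<in> parcs G" "v \<in> ball" "w \<notin> ball"
  shows "Suc (p v) = K" "w \<in> up v" "q w = K - 1"
proof -
  have w: "w \<in> nbrs G v" using assms by (simp add: nbrs_def)
  then have "p w = Suc (p v)" "Suc (p v) = K"
    using nbr_levels(1)[OF w] assms G.in_arcsD2[OF assms(1)] nbr_cases[OF assms(2) w] by (auto simp: ball_def)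
  then show "Suc (p v) = K" "w \<in> up v" using w by (auto simp: up_def)
  then show "q w = K - 1" using leaf_up assms by blast
qed

lemma disjoint: "ball \<inter> other = {}"
  using not_both by (fastforce simp: ball_def other_def)

lemma arc_stays:
  assumes "(v, w) \<in> parcs G" "v \<in> ball"
  shows "w \<in> ball \<union> other"
proof (cases "w \<in> ball")
  case False
  then show ?thesis using arc_out(3)[OF assms] K2 G.in_arcsD2[OF assms(1)] by (simp add: other_def)
qed simp

definition cross :: "('a \<times> 'a) set" where "cross = parcs G \<inter> ball \<times> other"

lemma cross_sub: "cross \<subseteq> leaves T x \<times> {v \<in> pverts G. q v = K - 1}"
proof -
  have "v \<in> leaves T x \<and> w \<in> pverts G \<and> q w = K - 1" if "(v, w) \<in> cross" for v w
  proof -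
    have "(v, w) \<in> parcs G" "v \<in> ball" "w \<notin> ball" using that disjoint by (auto simp: cross_def)
    then show ?thesis using arc_out[of v w] G.in_arcsD2[of v w] leaf_iff by blast
  qed
  then show ?thesis by auto
qed

text \<open>A leaf has one neighbour in its tree and hence \<open>d - 1\<close> cross arcs.\<close>
lemma card_cross: "card cross = d * (d - 1) ^ (K - 1)"
proof -
  have "(v, w) \<in> cross \<longleftrightarrow> v \<in> leaves T x \<and> w \<in> up v" for v w
  proof
    assume vw: "(v, w) \<in> cross"
    then have "(v, w) \<in> parcs G" "v \<in> ball" "w \<notin> ball" using disjoint by (auto simp: cross_def)
    then show "v \<in> leaves T x \<and> w \<in> up v" using arc_out[of v w] cross_sub vw by blast
  next
    assume vw: "v \<in> leaves T x \<and> w \<in> up v"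
    then have v: "v \<in> ball" "Suc (p v) = K" using leaf_iff by auto
    moreover have "(v, w) \<in> parcs G" using vw by (simp add: up_def nbrs_def)
    moreover have "w \<in> other"
      using leaf_up(2)[OF v, of w] vw K2 G.in_arcsD2[OF \<open>(v, w) \<in> parcs G\<close>] by (simp add: other_def)
    ultimately show "(v, w) \<in> cross" by (simp add: cross_def)
  qed
  then have "cross = Sigma (leaves T x) up" by auto
  moreover have "card (up v) = d - 1" if "v \<in> leaves T x" for v
    using that card_up[of v] K2 P.lev_root by (auto simp: leaf_iff)
  moreover have "finite (leaves T x)" using G.pair_finite_verts by (simp add: leaves_T)
  ultimately have "card cross = card (leaves T x) * (d - 1)"
    by (simp add: card_SigmaI up_def)
  also have "\<dots> = d * (d - 1) ^ Suc (K - 2)" unfolding card_leaves by simp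
  also have "Suc (K - 2) = K - 1" using K2 by simp
  finally show ?thesis .
qed

end

context tight_ball_pair begin

interpretation S: tight_ball_pair G d K y x q p by (rule swap_tight)

lemma other_eq: "other = S.ball" "S.other = ball"
  by (simp_all add: other_def S.ball_def S.other_def ball_def)

text \<open>No arc leaves the union of the two balls.\<close>
lemma covers: "pverts G = ball \<union> S.ball"
proof (intro equalityI subsetI)
  fix v assume "v \<in> pverts G"
  then show "v \<in> ball \<union> S.ball"
  proof (induction "p v" arbitrary: v rule: less_induct)
    case less
    show ?case
    proof (cases "v = x")
      case False
      then obtain u where u: "(u, v) \<in> parcs G" "p v = Suc (p u)" using P.lev_pred less.prems by blast
      then have "u \<in> ball \<union> S.ball" using less.hyps[of u] G.in_arcsD1 by auto
      then show ?thesis using arc_stays[OF u(1)] S.arc_stays[OF u(1)] other_eq by auto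
    qed (use x_ball in simp)
  qed
qed (use ball_sub S.ball_sub in auto)

lemma two_trees: "two_bethe_trees d K G"
  unfolding two_bethe_trees_def
proof (intro exI conjI)
  show "bethe_tree d K T x" by (rule bethe_tree_T)
  show "bethe_tree d K S.T y" by (rule S.bethe_tree_T)
  show "pverts T \<inter> pverts S.T = {}" "pverts G = pverts T \<union> pverts S.T"
    using disjoint covers by (simp_all add: T_simps S.T_simps other_eq)
  show "cross \<subseteq> leaves T x \<times> leaves S.T y" using cross_sub by (simp add: S.leaves_T)
  show "card cross = d * (d - 1) ^ (K - 1)" by (rule card_cross)
  have "e \<in> parcs T \<union> parcs S.T \<union> cross \<union> cross\<inverse>" if "e \<in> parcs G" for e
    using that covers G.in_arcsD1[of "fst e" "snd e"] G.in_arcsD2[of "fst e" "snd e"] G.arcs_symmetric[of "fst e" "snd e"]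
    by (cases e) (auto simp: T_simps S.T_simps cross_def other_eq)
  moreover have "cross\<inverse> \<subseteq> parcs G" using G.arcs_symmetric by (auto simp: cross_def)
  ultimately show "parcs G = parcs T \<union> parcs S.T \<union> cross \<union> cross\<inverse>"
    by (auto simp: T_simps S.T_simps cross_def)
qed

text \<open>
  Cross arcs join vertices of equal depth \<open>K - 1\<close>, so the parity of the depth has to be read with
  opposite meaning in the two trees.
\<close>
lemma bipartite_G: "bipartite G"
  unfolding bipartite_def
proof (intro exI conjI)
  let ?c = "\<lambda>v. if v \<in> ball then even (p v) else odd (q v)"
  show "{v \<in> pverts G. ?c v} \<union> {v \<in> pverts G. \<not> ?c v} = pverts G"
    "{v \<in> pverts G. ?c v} \<inter> {v \<in> pverts G. \<not> ?c v} = {}" by auto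
  have "?c v \<noteq> ?c w" if "(v, w) \<in> parcs G" for v w
  proof -
    have vw: "v \<in> ball \<or> v \<in> S.ball" "w \<in> nbrs G v" "w \<in> ball \<or> w \<in> S.ball" "(w, v) \<in> parcs G"
      using covers that G.in_arcsD1 G.in_arcsD2 G.arcs_symmetric by (auto simp: nbrs_def)
    have out: "Suc (p v) = K \<and> q w = K - 1" if "(v, w) \<in> parcs G" "v \<in> ball" "w \<notin> ball" for v w
      using arc_out[OF that] by simp
    have K1: "Suc (p v) = K \<Longrightarrow> q w = K - 1 \<Longrightarrow> p v = q w" for v w by simp
    show ?thesis
    proof (cases "v \<in> ball"; cases "w \<in> ball")
      assume "v \<in> ball" "w \<in> ball"
      then show ?thesis using nbr_cases[of v w] vw by auto
    next
      assume "v \<in> ball" "w \<notin> ball"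
      then show ?thesis using out[OF that] K1[of v w] by auto
    next
      assume "v \<notin> ball" "w \<in> ball"
      then show ?thesis using out[OF vw(4)] K1[of w v] by auto
    next
      assume "v \<notin> ball" "w \<notin> ball"
      then show ?thesis using S.nbr_cases[of v w] vw by auto
    qed
  qed
  then show "\<forall>(v, w)\<in>parcs G. v \<in> {v \<in> pverts G. ?c v} \<and> w \<in> {v \<in> pverts G. \<not> ?c v} \<or>
      v \<in> {v \<in> pverts G. \<not> ?c v} \<and> w \<in> {v \<in> pverts G. ?c v}"
    using G.in_arcsD1 G.in_arcsD2 by blast
qed

lemma card_verts: "card (pverts G) = 2 * (1 + d * (\<Sum>j<K - 1. (d - 1) ^ j))"
proof -
  have "finite ball" "finite S.ball"
    using G.pair_finite_verts ball_sub S.ball_sub finite_subset by blast+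
  then show ?thesis
    unfolding covers using disjoint other_eq card_ball S.card_ball by (simp add: card_Un_disjoint)
qed

end

section \<open>The theorem\<close>

theorem theoremI3:
  fixes G :: "'a pair_pre_digraph" and d K :: nat
  assumes "d \<ge> 3" and "K \<ge> 1"
    and "pair_graph G" and "connected G"
    and "regular G d" and "gdiam G = 2 * K - 1"
    and "diameter_maximal d K G"
  shows "bipartite G \<and>
         two_bethe_trees d K G \<and>
         card (pverts G) = 2 * (1 + d * (\<Sum>j<K - 1. (d - 1) ^ j)) \<and>
         real (card (pverts G)) =
           2 * ((real d * (real d - 1) ^ (K - 1) - 2) / (real d - 2))"
proof -
  interpret pair_graph G by fact
  let ?V = "pverts G"
  define s where "s = sqrt (real d - 1)"
  have s1: "s > 1" using assms(1) by (simp add: s_def)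
  obtain \<theta> where \<theta>: "smallest_pos_theta_root d K \<theta>"
    and AC: "algebraic_connectivity G = real d - 2 * s * cos \<theta>"
    using assms(7) by (auto simp: diameter_maximal_def s_def)
  have deg: "card (nbrs G v) = d" if "v \<in> ?V" for v
    using assms(5) that by (simp add: regular_def out_degree_nbrs)
  have rayleigh: "(\<Sum>v\<in>?V. f v * (\<Sum>w\<in>nbrs G v. f w)) \<le> 2 * s * cos \<theta> * (\<Sum>v\<in>?V. (f v)\<^sup>2)"
    if xy: "x \<in> ?V" "y \<in> ?V" "x \<noteq> y" and f0: "(\<Sum>v\<in>?V. f v) = 0" for f and x y
  proof -
    have "(\<Sum>v\<in>?V. f v * (\<Sum>w\<in>nbrs G v. f v - f w))
        = (\<Sum>v\<in>?V. d * (f v)\<^sup>2 - f v * (\<Sum>w\<in>nbrs G v. f w))"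
      by (intro sum.cong refl) (simp add: sum_subtractf deg power2_eq_square algebra_simps)
    also have "\<dots> = d * (\<Sum>v\<in>?V. (f v)\<^sup>2) - (\<Sum>v\<in>?V. f v * (\<Sum>w\<in>nbrs G v. f w))"
      by (simp add: sum_subtractf sum_distrib_left)
    finally show ?thesis
      using algebraic_connectivity_rayleigh[OF assms(4) xy f0] unfolding AC by (simp add: algebra_simps)
  qed
  have "?V \<noteq> {}" using assms(4) by (auto simp: connected_def strongly_connected_def)
  \<comment> \<open>Otherwise \<open>\<theta> = pi\<close>, and the algebraic connectivity \<open>d + 2 s\<close> exceeds the Rayleigh quotient
     \<open>d + 1\<close> of the difference of the indicators of two adjacent vertices.\<close>
  have "K \<noteq> 1"
  proof
    assume "K = 1"
    then have c: "cos \<theta> = - 1" using smallest_theta_root_1 assms(1) \<theta> by simp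
    obtain x where x: "x \<in> ?V" using \<open>?V \<noteq> {}\<close> by blast
    then have "nbrs G x \<noteq> {}" using deg[OF x] assms(1) by auto
    then obtain y where "y \<in> nbrs G x" by blast
    then have y: "y \<in> ?V" "x \<noteq> y" using nbrs_in_verts nbrs_irrefl by auto
    define f where "f v = (if v = x then 1 else 0) - (if v = y then 1 else 0 :: real)" for v
    have "(\<Sum>v\<in>?V. f v) = 0" using x y pair_finite_verts by (simp add: f_def sum_subtractf)
    from rayleigh[OF x y this]
    have "(\<Sum>v\<in>?V. f v * (\<Sum>w\<in>nbrs G v. f w)) \<le> - (2 * s) * (\<Sum>v\<in>?V. (f v)\<^sup>2)"
      by (simp add: c)
    also have "(\<Sum>v\<in>?V. (f v)\<^sup>2) = (\<Sum>v\<in>?V. (if v = x then 1 else 0) + (if v = y then 1 else 0))"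
      using y by (intro sum.cong) (auto simp: f_def)
    also have "\<dots> = 2" using x y pair_finite_verts by (simp add: sum.distrib)
    also have "(\<Sum>v\<in>?V. f v * (\<Sum>w\<in>nbrs G v. f w))
        = (\<Sum>v\<in>?V. if v = x then \<Sum>w\<in>nbrs G v. f w else 0) - (\<Sum>v\<in>?V. if v = y then \<Sum>w\<in>nbrs G v. f w else 0)"
      unfolding sum_subtractf[symmetric] by (intro sum.cong refl) (auto simp: f_def)
    also have "\<dots> = (\<Sum>w\<in>nbrs G x. f w) - (\<Sum>w\<in>nbrs G y. f w)"
      using x y pair_finite_verts by simp
    also have "(\<Sum>w\<in>nbrs G x. f w) = - 1"
      using \<open>y \<in> nbrs G x\<close> nbrs_irrefl[of x] by (simp add: f_def sum_subtractf)
    also have "(\<Sum>w\<in>nbrs G y. f w) = 1"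
      using \<open>y \<in> nbrs G x\<close> nbrs_irrefl[of y] nbrs_sym[of y x] by (simp add: f_def sum_subtractf)
    finally show False using s1 by simp
  qed
  then have K: "K \<ge> 2" using assms(2) by simp
  obtain x y where xy: "x \<in> ?V" "y \<in> ?V" "gdist G x y = 2 * K - 1"
  proof -
    let ?D = "{gdist G u v | u v. u \<in> ?V \<and> v \<in> ?V}"
    have "?D = (\<lambda>(u, v). gdist G u v) ` (?V \<times> ?V)" by auto
    then have "finite ?D" "?D \<noteq> {}" using pair_finite_verts \<open>?V \<noteq> {}\<close> by auto
    from Max_in[OF this] show thesis using that assms(6) by (auto simp: gdiam_def)
  qed
  interpret X: level_function G x "gdist G x" using gdist_level_function assms(4) xy(1) .
  interpret Y: level_function G y "gdist G y" using gdist_level_function assms(4) xy(2) .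
  have "x \<noteq> y" using xy(3) X.lev_root K by auto
  have far: "2 * K - 1 \<le> gdist G x v + gdist G y v" if "v \<in> ?V" for v
    using gdist_triangle[OF assms(4) xy(1,2) that] xy(3) by simp
  interpret ball_pair G d K x y "gdist G x" "gdist G y"
    by unfold_locales (use deg assms(1) K far in auto)
  obtain a :: "nat \<Rightarrow> real" where a: "\<And>j. j < K \<Longrightarrow> a j > 0" "\<And>j. j < K \<Longrightarrow> a (Suc j) < a j" "a K = - a (K - 1)"
    "2 * s * cos \<theta> * a 0 = d * a 1"
    "\<And>j. 2 * s * cos \<theta> * a (Suc j) = a j + (real d - 1) * a (Suc (Suc j))"
    using radial_profile[OF assms(1) K _ smallest_theta_root_bounds[OF assms(1) K \<theta>]] \<theta>
    unfolding smallest_pos_theta_root_def s_def by metis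
  note tight = tight_of_rayleigh[OF a rayleigh[OF xy(1,2) \<open>x \<noteq> y\<close>]]
  interpret tight_ball_pair G d K x y "gdist G x" "gdist G y"
    by unfold_locales (rule tight; assumption)+
  have "real (card ?V) = 2 * (1 + real d * (\<Sum>j<K - 1. (real d - 1) ^ j))"
    using card_verts assms(1) by (simp add: of_nat_diff)
  also have "(\<Sum>j<K - 1. (real d - 1) ^ j) = ((real d - 1) ^ (K - 1) - 1) / (real d - 2)"
    using geometric_sum[of "real d - 1" "K - 1"] assms(1) by simp
  also have "2 * (1 + real d * (((real d - 1) ^ (K - 1) - 1) / (real d - 2)))
      = 2 * ((real d * (real d - 1) ^ (K - 1) - 2) / (real d - 2))"
    using assms(1) by (simp add: field_simps)
  finally show ?thesis using bipartite_G two_trees card_verts by simp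
qed

end
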